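(* Let $R_z(a)$ be a family of tileable tubey regions (with core $R$, tube height $h$ and common tube western boundary $z$). Let $g(a)=M(R_z(a+1/2))$ and $\overline g(a)=M(\overline R_z(a+1/2))$ for $a\in\mathbb N$. Then both $g(a)$ and $\overline g(a)$ are polynomials in $a$, and $$\overline g(a)=g(a-1/2).$$
   Context: Work on the triangular lattice of the plane with some lattice lines horizontal; its unit equilateral triangles are called triangles. A region is a connected bounded union of triangles. A lozenge is the union of two triangles sharing an edge; a lozenge tiling of a region is a covering of it by lozenges contained in it with pairwise disjoint interiors. Lozenges may carry weights; the weight of a tiling is the product of its lozenges' weights, and $M(R)$ is the sum of the weights of the tilings of $R$ (the number of tilings if all weights are 1; a region with no specified weights is unweighted). A vertical lozenge is one consisting of two triangles sharing a horizontal edge. Tube: for $a\in\frac12\mathbb N$ and a positive integer $h$, $T(a,h)$ is the region of triangles lying within the rectangle whose horizontal sides (segments of horizontal lattice lines) have length $a+1/2$ and whose vertical sides have length $h\sqrt3$, positioned so that its top left corner is at the midpoint of the base of a triangle. Tubey regions: consider tubes $T(a,h)$, for all lengths $a$, that share a fixed western boundary $z$ (a zigzag path of lattice edges), and a region $R$ in a fixed position relative to $z$ that meets none of these tubes except along $z$. Then $R_z(0)=R$ and $R_z(a)=R\cup T(a,h)$; $R$ is called the core. The region $\overline R_z(a)$ is $R_z(a)$ with each vertical lozenge sharing two edges with the eastern boundary of the tube given weight $1/2$ (all other lozenges keep their weights from $R_z(a)$). The family is called tileable if the regions $R_z(a)$ are tileable. *)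

theory Defs
  imports "HOL-Analysis.Analysis" "HOL-Computational_Algebra.Polynomial"
begin

section \<open>The triangular lattice\<close>

text \<open>
  Lattice points are written in the basis of the unit vector pointing east and the unit vector at
  60 degrees to it, so that the horizontal lattice lines are the lines of constant second index.
\<close>

type_synonym vertex = "int \<times> int"

definition point :: "vertex \<Rightarrow> real \<times> real" where
  "point v = (of_int (fst v) + of_int (snd v) / 2, of_int (snd v) * sqrt 3 / 2)"

text \<open>
  \<open>Up i j\<close> points upwards and has its base from (i, j) to (i+1, j); \<open>Down i j\<close> points
  downwards and has its base from (i, j+1) to (i+1, j+1).
\<close>

datatype triangle = Up int int | Down int int

fun verts :: "triangle \<Rightarrow> vertex set" where
  "verts (Up i j) = {(i, j), (i + 1, j), (i, j + 1)}"
| "verts (Down i j) = {(i, j + 1), (i + 1, j + 1), (i + 1, j)}"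

definition edges :: "triangle \<Rightarrow> vertex set set" where
  "edges t = {e. e \<subseteq> verts t \<and> card e = 2}"

definition face :: "vertex set \<Rightarrow> (real \<times> real) set" where
  "face V = convex hull (point ` V)"

text \<open>A union of triangles is given by the set of these triangles; this is the planar set.\<close>

definition area :: "triangle set \<Rightarrow> (real \<times> real) set" where
  "area R = (\<Union>t\<in>R. face (verts t))"

definition region :: "triangle set \<Rightarrow> bool" where
  "region R \<longleftrightarrow> bounded (area R) \<and> connected (area R)"


section \<open>Lozenges and tilings\<close>

definition lozenge :: "triangle set \<Rightarrow> bool" where
  "lozenge L \<longleftrightarrow> (\<exists>s t. s \<noteq> t \<and> edges s \<inter> edges t \<noteq> {} \<and> L = {s, t})"

definition vertical_lozenge :: "triangle set \<Rightarrow> bool" where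
  "vertical_lozenge L \<longleftrightarrow>
     (\<exists>s t i j. s \<noteq> t \<and> {(i, j), (i + 1, j)} \<in> edges s \<inter> edges t \<and> L = {s, t})"

text \<open>Lozenges have disjoint interiors if and only if they have no triangle in common.\<close>

definition tilings :: "triangle set \<Rightarrow> triangle set set set" where
  "tilings R = {T. partition_on R T \<and> (\<forall>L\<in>T. lozenge L)}"

definition tileable :: "triangle set \<Rightarrow> bool" where
  "tileable R \<longleftrightarrow> tilings R \<noteq> {}"

definition M :: "(triangle set \<Rightarrow> real) \<Rightarrow> triangle set \<Rightarrow> real" where
  "M w R = (\<Sum>T\<in>tilings R. \<Prod>L\<in>T. w L)"


section \<open>Tubes\<close>

definition half_nats :: "real set" where
  "half_nats = {a. \<exists>n::nat. a = real n / 2}"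

text \<open>
  The top left corner of the rectangle is the midpoint of the horizontal lattice edge from (p, q)
  to (p+1, q).
\<close>

definition rectangle :: "int \<Rightarrow> int \<Rightarrow> real \<Rightarrow> nat \<Rightarrow> (real \<times> real) set" where
  "rectangle p q a h =
     (let (x, y) = midpoint (point (p, q)) (point (p + 1, q))
      in {x .. x + (a + 1 / 2)} \<times> {y - real h * sqrt 3 .. y})"

definition tube :: "int \<Rightarrow> int \<Rightarrow> real \<Rightarrow> nat \<Rightarrow> triangle set" where
  "tube p q a h = {t. face (verts t) \<subseteq> rectangle p q a h}"

text \<open>
  The western (eastern) boundary of a tube is the zigzag path through the leftmost (rightmost)
  lattice point of the rectangle on each horizontal lattice line.  For a = 0 the tube has no
  triangles and both boundaries are the same path.
\<close>

definition western_boundary :: "int \<Rightarrow> int \<Rightarrow> real \<Rightarrow> nat \<Rightarrow> vertex set set" where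
  "western_boundary p q a h =
     {e. (\<exists>t. e \<in> edges t) \<and>
         (\<forall>(i, j)\<in>e. point (i, j) \<in> rectangle p q a h \<and> point (i - 1, j) \<notin> rectangle p q a h)}"

definition eastern_boundary :: "int \<Rightarrow> int \<Rightarrow> real \<Rightarrow> nat \<Rightarrow> vertex set set" where
  "eastern_boundary p q a h =
     {e. (\<exists>t. e \<in> edges t) \<and>
         (\<forall>(i, j)\<in>e. point (i, j) \<in> rectangle p q a h \<and> point (i + 1, j) \<notin> rectangle p q a h)}"

lemma point_in_rectangle_iff:
  "point (i, j) \<in> rectangle p q a h \<longleftrightarrow>
     2 * p + q + 1 \<le> 2 * i + j \<and> of_int (2 * i + j) \<le> of_int (2 * p + q) + 2 * a + 2 \<and>
     q - 2 * int h \<le> j \<and> j \<le> q"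
proof -
  have "of_int q * sqrt 3 / 2 - real h * sqrt 3 \<le> of_int j * sqrt 3 / 2
      \<longleftrightarrow> (of_int (q - 2 * int h) :: real) * sqrt 3 \<le> of_int j * sqrt 3"
    by (simp add: algebra_simps)
  also have "\<dots> \<longleftrightarrow> q - 2 * int h \<le> j"
    by (subst mult_le_cancel_right) (auto simp del: of_int_diff)
  finally have "of_int q * sqrt 3 / 2 - real h * sqrt 3 \<le> of_int j * sqrt 3 / 2
      \<longleftrightarrow> q - 2 * int h \<le> j" .
  moreover have "of_int p + 1 / 2 + of_int q / 2 \<le> (of_int i + of_int j / 2 :: real)
      \<longleftrightarrow> 2 * p + q + 1 \<le> 2 * i + j"
    by linarith
  moreover have "midpoint (point (p, q)) (point (p + 1, q)) =
      (of_int p + 1 / 2 + of_int q / 2, of_int q * sqrt 3 / 2)"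
    by (simp add: midpoint_def point_def field_simps)
  ultimately show ?thesis
    by (auto simp: rectangle_def point_def field_simps)
qed

text \<open>All the tubes in the same position share their western boundary.\<close>

lemma western_boundary_eq:
  assumes "a \<ge> 0"
  shows "western_boundary p q a h = western_boundary p q 0 h"
proof -
  have "(point (i, j) \<in> rectangle p q a h \<and> point (i - 1, j) \<notin> rectangle p q a h) \<longleftrightarrow>
        (point (i, j) \<in> rectangle p q 0 h \<and> point (i - 1, j) \<notin> rectangle p q 0 h)" for i j
    unfolding point_in_rectangle_iff using assms by auto
  then show ?thesis
    unfolding western_boundary_def by simp
qed


section \<open>Tubey regions\<close>

text \<open>
  The core and the tubes are compared as closed sets, so a core that touches the top or the bottom
  side of a tube is excluded.
\<close>

definition tubey_core :: "int \<Rightarrow> int \<Rightarrow> nat \<Rightarrow> triangle set \<Rightarrow> bool" where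
  "tubey_core p q h R \<longleftrightarrow>
     region R \<and>
     (\<forall>a\<in>half_nats. area R \<inter> area (tube p q a h) \<subseteq> (\<Union>e\<in>western_boundary p q a h. face e))"

definition tubey_region :: "int \<Rightarrow> int \<Rightarrow> nat \<Rightarrow> triangle set \<Rightarrow> real \<Rightarrow> triangle set" where
  "tubey_region p q h R a = R \<union> tube p q a h"

definition overline_weight ::
    "int \<Rightarrow> int \<Rightarrow> nat \<Rightarrow> (triangle set \<Rightarrow> real) \<Rightarrow> real \<Rightarrow> triangle set \<Rightarrow> real" where
  "overline_weight p q h w a L =
     (if vertical_lozenge L \<and> card ((\<Union>t\<in>L. edges t) \<inter> eastern_boundary p q a h) = 2
      then 1 / 2 else w L)"

end

theory Submission
  imports "Jordan_Normal_Form.Determinant" Defs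
begin

text \<open>
  Cut the tube into columns.  The rows in which a tiling crosses from one column to the next, with
  every second row complemented, are \<open>h\<close> particles.  Passing a column, particles in rows of one
  parity may move to the row above if it is free, and the parity alternates.  Such moves act on
  minors as row operations, so the number of tilings of the tube that avoid given places along the
  western boundary is a minor of the matrix of single path counts.  A single path from row \<open>x\<close> to
  row \<open>x - d\<close> is counted by the binomial coefficient of \<open>y + \<lfloor>(d - 1) / 2\<rfloor>\<close> over \<open>d\<close>, where \<open>y = a + 1\<close>.
  This is polynomial in \<open>y\<close> and satisfies the path recurrence for all real \<open>y\<close>, and its values at
  \<open>y = 1/2\<close> are initial values for a last column with weights 1/2.  These weights therefore replace
  \<open>y = a + 1\<close> by \<open>y = a + 1/2\<close>.  Cutting a tiling of the whole region along the western boundary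
  gives a linear combination of such minors, whose coefficients depend on the core only.
\<close>

section \<open>Minors and moves of rows\<close>

text \<open>Complementing one parity turns a vertical lozenge, which removes two rows from play,
  into one particle moving by one row, so the number of particles is conserved. It is
  \<open>h\<close> at the eastern end, where nothing crosses any more; hence the value 0 of
  \<open>minor\<close> for sets of another size is the correct count. Collisions need no argument
  about paths: a forbidden move gives a determinant with two equal rows. The constant 1/2 comes from
  the absorption identity. In the last column a particle in an even row must move, with weight s, so
  each even row of the initial matrix has to be s times the row above it. At y = s absorption
  produces the factor (s + k) / (2 k + 1), which is independent of k exactly for s = 1/2. The price
  is that at y = 1/2 the odd rows do not form the identity matrix, as weights of single paths would,
  but a unitriangular one. Minors of full width do not see the difference: the shift by 1/2 is a
  fact about determinants, not about their entries.\<close>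

definition row_det :: "nat \<Rightarrow> (nat \<Rightarrow> nat \<Rightarrow> real) \<Rightarrow> real" where
  "row_det n F = Determinant.det (Matrix.mat n n (\<lambda>(i, j). F i j))"

lemma row_det_sum:
  "row_det n F = (\<Sum>\<pi> | \<pi> permutes {0..<n}. signof \<pi> * (\<Prod>i = 0..<n. F i (\<pi> i)))"
proof -
  have "(\<Prod>i = 0..<n. Matrix.mat n n (\<lambda>(i, j). F i j) $$ (i, \<pi> i)) = (\<Prod>i = 0..<n. F i (\<pi> i))"
    if "\<pi> permutes {0..<n}" for \<pi>
    using permutes_in_image[OF that] by (intro prod.cong) auto
  then show ?thesis
    unfolding row_det_def by (subst det_def') auto
qed

lemma row_det_cong:
  assumes "\<And>i j. i < n \<Longrightarrow> j < n \<Longrightarrow> F i j = G i j"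
  shows "row_det n F = row_det n G"
  unfolding row_det_def using assms by (intro arg_cong[of _ _ Determinant.det] eq_matI) auto

lemma row_det_linear:
  assumes "k < n"
  shows "row_det n (F(k := \<lambda>j. a j + s * b j)) = row_det n (F(k := a)) + s * row_det n (F(k := b))"
proof -
  have split: "(\<Prod>i = 0..<n. (F(k := g)) i (\<pi> i)) = g (\<pi> k) * (\<Prod>i\<in>{0..<n} - {k}. F i (\<pi> i))" for g \<pi>
    using assms by (subst prod.remove[of _ k]) (auto intro!: prod.cong)
  show ?thesis
    unfolding row_det_sum split
    by (simp add: algebra_simps sum.distrib sum_distrib_left)
qed

lemma row_det_same:
  assumes "i < n" "k < n" "i \<noteq> k" "F i = F k"
  shows "row_det n F = 0"
  unfolding row_det_def
  by (rule Determinant.det_identical_rows[of _ n i k]) (use assms in \<open>auto simp: Matrix.row_def\<close>)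

lemma row_det_zero_row:
  assumes "k < n" "\<And>j. j < n \<Longrightarrow> F k j = 0"
  shows "row_det n F = 0"
proof -
  have "(\<Prod>i = 0..<n. F i (\<pi> i)) = 0" if "\<pi> permutes {0..<n}" for \<pi>
    using permutes_in_image[OF that, of k] assms by (intro prod_zero bexI[of _ k]) auto
  then show ?thesis
    unfolding row_det_sum by (intro sum.neutral) simp
qed

lemma row_det_unitriangular:
  assumes "\<And>i j. i < j \<Longrightarrow> j < n \<Longrightarrow> F i j = 0" "\<And>i. i < n \<Longrightarrow> F i i = 1"
  shows "row_det n F = 1"
proof -
  let ?A = "Matrix.mat n n (\<lambda>(i, j). F i j)"
  have "Determinant.det ?A = prod_list (diag_mat ?A)"
    by (rule det_lower_triangular[of n]) (use assms in auto)
  also have "diag_mat ?A = replicate n 1"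
    by (rule nth_equalityI) (use assms in \<open>auto simp: diag_mat_def\<close>)
  finally show ?thesis
    by (simp add: row_det_def)
qed

text \<open>Junk value: \<open>minor h f P\<close> is 0 unless \<open>P\<close> has exactly \<open>h\<close> elements.\<close>

definition minor :: "nat \<Rightarrow> (int \<Rightarrow> nat \<Rightarrow> real) \<Rightarrow> int set \<Rightarrow> real" where
  "minor h f P = (if card P = h then row_det h (\<lambda>i. f (sorted_list_of_set P ! i)) else 0)"

definition movable :: "int set \<Rightarrow> int set" where
  "movable P = {x \<in> P. x - 1 \<notin> P}"

definition move :: "int set \<Rightarrow> int set \<Rightarrow> int set" where
  "move V P = P - V \<union> (\<lambda>x. x - 1) ` V"

text \<open>A column read from east to west: \<open>f\<close> describes what can follow after it. A
  particle in a row of \<open>A\<close> stays, or goes to the row above with weight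
  \<open>s\<close>.\<close>

definition step :: "real \<Rightarrow> int set \<Rightarrow> (int \<Rightarrow> nat \<Rightarrow> real) \<Rightarrow> int \<Rightarrow> nat \<Rightarrow> real" where
  "step s A f x j = f x j + (if x \<in> A then s * f (x - 1) j else 0)"

lemma minor_cong:
  assumes "finite P" "\<And>x j. x \<in> P \<Longrightarrow> j < h \<Longrightarrow> f x j = g x j"
  shows "minor h f P = minor h g P"
proof (cases "card P = h")
  case True
  have "sorted_list_of_set P ! i \<in> P" if "i < h" for i
    using that True assms(1) by (metis length_sorted_list_of_set nth_mem set_sorted_list_of_set)
  then show ?thesis
    unfolding minor_def using assms(2) by (auto intro!: row_det_cong)
qed (simp add: minor_def)

text \<open>Row \<open>x - 1\<close> is free, so no particle is overtaken: the order is kept, the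
  row of the matrix changes in place and no sign arises.\<close>

lemma sorted_list_of_set_move:
  fixes P :: "int set"
  assumes "finite P" "i < card P" "sorted_list_of_set P ! i = x" "x - 1 \<notin> P"
  shows "sorted_list_of_set (move {x} P) = (sorted_list_of_set P)[i := x - 1]"
proof -
  let ?xs = "sorted_list_of_set P" and ?ys = "(sorted_list_of_set P)[i := x - 1]"
  have len: "length ?xs = card P" by simp
  have st: "sorted_wrt (<) ?xs" by (rule sorted_list_of_set.strict_sorted_key_list_of_set)
  have mono: "?xs ! k < ?xs ! l" if "k < l" "l < card P" for k l
    using sorted_wrt_nth_less[OF st that(1)] that(2) len by simp
  have mem: "?xs ! k \<in> P" if "k < card P" for k
    using that assms(1) len by (metis nth_mem set_sorted_list_of_set)
  have "sorted_wrt (<) ?ys"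
  proof (unfold sorted_wrt_iff_nth_less, intro allI impI)
    fix k l assume kl: "k < l" "l < length ?ys"
    then have kl': "k < card P" "l < card P" by simp_all
    have lt: "?xs ! k < ?xs ! l" using mono[OF kl(1) kl'(2)] .
    have "?xs ! k \<noteq> x - 1" using mem[OF kl'(1)] assms(4) by metis
    then have "?xs ! k < x - 1" if "l = i" using lt[unfolded that assms(3)] by linarith
    moreover have "x - 1 < ?xs ! l" if "k = i" using lt[unfolded that assms(3)] by linarith
    ultimately show "?ys ! k < ?ys ! l"
      using kl(1) kl' lt by (cases "k = i"; cases "l = i") simp_all
  qed
  then have sorted: "sorted ?ys" "distinct ?ys"
    by (simp_all only: strict_sorted_iff)
  have set: "move {x} P = set ?ys"
  proof -
    have "distinct ?xs" by simp
    then have "set ?ys = insert (x - 1) (set ?xs - {?xs ! i})"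
      using assms(2) len by (intro set_update_distinct) auto
    then show ?thesis
      using assms(1,3) by (auto simp: move_def)
  qed
  show ?thesis
    unfolding set by (rule sorted_list_of_set.idem_if_sorted_distinct[OF sorted])
qed

lemma card_move_single:
  assumes "finite P" "x \<in> movable P"
  shows "card (move {x} P) = card P"
proof -
  have "x \<in> P" "x - 1 \<notin> P" using assms(2) by (auto simp: movable_def)
  then show ?thesis
    using assms(1) card_Suc_Diff1[of P x] by (simp add: move_def)
qed

text \<open>Linearity of the determinant in the row of \<open>x\<close>. If \<open>x - 1\<close> is
  occupied, the extra term has two equal rows and vanishes, which is the exclusion rule of the
  particles.\<close>

lemma minor_step_single:
  assumes P: "finite P"
  shows "minor h (step s {x} f) P =
    minor h f P + (if x \<in> movable P then s * minor h f (move {x} P) else 0)"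
proof (cases "card P = h \<and> x \<in> P")
  case False
  have "minor h (step s {x} f) P = minor h f P" if "x \<notin> P"
    using P that by (intro minor_cong) (auto simp: step_def)
  moreover have "card (move {x} P) = card P" if "x \<in> movable P"
    using P that by (rule card_move_single)
  ultimately show ?thesis
    using False by (auto simp: movable_def minor_def)
next
  case True
  let ?xs = "sorted_list_of_set P"
  have len: "length ?xs = h" using True by simp
  obtain i where i: "i < h" "?xs ! i = x"
    using True P len by (metis in_set_conv_nth set_sorted_list_of_set)
  have inj: "?xs ! k = x \<longleftrightarrow> k = i" if "k < h" for k
    using that i len by (metis distinct_sorted_list_of_set nth_eq_iff_index_eq)
  define F where "F = (\<lambda>k. f (?xs ! k))"
  have "row_det h (\<lambda>k. step s {x} f (?xs ! k)) = row_det h (F(i := \<lambda>j. f x j + s * f (x - 1) j))"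
    using inj i by (intro row_det_cong) (auto simp: step_def F_def)
  also have "\<dots> = row_det h (F(i := f x)) + s * row_det h (F(i := f (x - 1)))"
    by (rule row_det_linear[OF i(1)])
  also have "F(i := f x) = F"
    using i by (auto simp: F_def)
  finally have *: "minor h (step s {x} f) P = minor h f P + s * row_det h (F(i := f (x - 1)))"
    using True by (simp add: minor_def F_def del: fun_upd_apply)
  show ?thesis
  proof (cases "x - 1 \<in> P")
    case mem: True
    then obtain k where k: "k < h" "?xs ! k = x - 1"
      using P len by (metis in_set_conv_nth set_sorted_list_of_set)
    then have "k \<noteq> i" using i by auto
    then have "row_det h (F(i := f (x - 1))) = 0"
      using k i by (intro row_det_same[of k _ i]) (auto simp: F_def)
    then show ?thesis
      using * mem by (simp add: movable_def)
  next
    case nmem: False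
    have "card (move {x} P) = h"
      using card_move_single[OF P, of x] True nmem by (simp add: movable_def)
    moreover have "row_det h (F(i := f (x - 1))) = row_det h (\<lambda>k. f (sorted_list_of_set (move {x} P) ! k))"
      using i True nmem P len
      by (subst sorted_list_of_set_move[of P i]) (auto intro!: row_det_cong simp: F_def nth_list_update)
    ultimately show ?thesis
      using * nmem True by (simp add: movable_def minor_def)
  qed
qed

text \<open>Since \<open>A\<close> contains no two adjacent rows, moving \<open>x\<close> neither
  enables nor blocks the move of another row of \<open>A\<close>. The row operations may therefore
  be done one at a time and their effects multiplied out.\<close>

lemma minor_step:
  assumes "finite A" "finite P" "\<And>x. x \<in> A \<Longrightarrow> x - 1 \<notin> A"
  shows "minor h (step s A f) P =
    (\<Sum>V\<in>Pow (A \<inter> movable P). s ^ card V * minor h f (move V P))"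
  using assms
proof (induction A arbitrary: P rule: finite_induct)
  case empty
  then show ?case
    by (simp add: step_def[abs_def] move_def)
next
  case (insert x A)
  let ?B = "A \<inter> movable P"
  have A: "y - 1 \<notin> A" "y - 1 \<noteq> x" "x - 1 \<noteq> y" if "y \<in> A" for y
    using insert.prems(2)[of y] insert.prems(2)[of x] that by auto
  have IH: "minor h (step s A f) Q = (\<Sum>V\<in>Pow (A \<inter> movable Q). s ^ card V * minor h f (move V Q))"
    if "finite Q" for Q
    using insert.IH[OF that] A by blast
  have "step s (insert x A) f = step s {x} (step s A f)"
    using insert.hyps insert.prems(2)[of x] by (intro ext) (auto simp: step_def)
  then have eq: "minor h (step s (insert x A) f) P = minor h (step s A f) P +
      (if x \<in> movable P then s * minor h (step s A f) (move {x} P) else 0)"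
    using minor_step_single[OF insert.prems(1)] by simp
  show ?case
  proof (cases "x \<in> movable P")
    case False
    then have "insert x A \<inter> movable P = ?B" by auto
    then show ?thesis
      using False eq IH[OF insert.prems(1)] by simp
  next
    case True
    have fin: "finite ?B" "x \<notin> ?B" using insert.hyps by auto
    have mov: "A \<inter> movable (move {x} P) = ?B"
      using A insert.hyps by (auto simp: movable_def move_def)
    have summand: "s * (s ^ card V * minor h f (move V (move {x} P))) =
        s ^ card (insert x V) * minor h f (move (insert x V) P)" if "V \<subseteq> ?B" for V
    proof -
      have "x \<notin> V" "finite V" using that fin finite_subset by blast+
      moreover have "move V (move {x} P) = move (insert x V) P"
        using that A insert.hyps by (auto simp: move_def)
      ultimately show ?thesis by simp
    qed
    have "insert x A \<inter> movable P = insert x ?B" using True by auto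
    then have "(\<Sum>V\<in>Pow (insert x A \<inter> movable P). s ^ card V * minor h f (move V P)) =
        (\<Sum>V\<in>Pow ?B. s ^ card V * minor h f (move V P)) +
        (\<Sum>V\<in>insert x ` Pow ?B. s ^ card V * minor h f (move V P))"
      using fin by (simp only: Pow_insert) (rule sum.union_disjoint, auto simp del: Pow_Int_eq)
    also have "(\<Sum>V\<in>insert x ` Pow ?B. s ^ card V * minor h f (move V P)) =
        (\<Sum>V\<in>Pow ?B. s ^ card (insert x V) * minor h f (move (insert x V) P))"
      using fin by (subst sum.reindex) (auto simp: inj_on_def)
    also have "\<dots> = s * minor h (step s A f) (move {x} P)"
    proof -
      have "finite (move {x} P)" using insert.prems(1) by (simp add: move_def)
      then show ?thesis
        unfolding IH[OF \<open>finite (move {x} P)\<close>] mov sum_distrib_left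
        using summand by (intro sum.cong) auto
    qed
    finally show ?thesis
      using True eq IH[OF insert.prems(1)] by simp
  qed
qed

section \<open>Counting single paths\<close>

text \<open>Column \<open>j\<close> of the matrix stands for the final row \<open>2 * j + 1\<close>,
  and \<open>d\<close> is the distance to it. The generalized binomial coefficient is taken because
  \<open>y\<close> will also be half of an odd number.\<close>

definition path_count :: "real \<Rightarrow> int \<Rightarrow> nat \<Rightarrow> real" where
  "path_count y x j = (let d = x - 2 * int j - 1
     in if d < 0 then 0 else (y + of_int ((d - 1) div 2)) gchoose nat d)"

text \<open>Pascal's rule twice, once for each parity of the distance. It holds for every real upper
  argument, so the recurrence does not notice whether \<open>y\<close> is an integer.\<close>

lemma path_count_step:
  assumes "1 \<le> x" "x \<le> 2 * int h"
  shows "step 1 {x. 2 \<le> x \<and> x \<le> 2 * int h \<and> even x}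
      (step 1 {x. 2 \<le> x \<and> x \<le> 2 * int h \<and> odd x} (path_count y)) x j = path_count (y + 1) x j"
proof -
  define d where "d = x - 2 * int j - 1"
  have x: "x = d + 2 * int j + 1" by (simp add: d_def)
  \<comment> \<open>The values between the two columns. For even \<open>e > 0\<close> Pascal's rule
    raises the upper argument by one; for odd \<open>e\<close> nothing changes, as
    \<open>(e - 1) div 2 = e div 2\<close>.\<close>
  define \<psi> where "\<psi> e = (if e < 0 then 0 else (y + of_int (e div 2)) gchoose nat e)" for e :: int
  have pc: "path_count z (e + 2 * int j + 1) j =
      (if e < 0 then 0 else (z + of_int ((e - 1) div 2)) gchoose nat e)" for z e
    by (simp add: path_count_def)
  have first: "step 1 {x. 2 \<le> x \<and> x \<le> 2 * int h \<and> odd x} (path_count y) (e + 2 * int j + 1) j = \<psi> e"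
    if "1 \<le> e + 2 * int j + 1" "e + 2 * int j + 1 \<le> 2 * int h" for e
  proof (cases "even e \<and> e > 0")
    case True
    then obtain k where k: "e = 2 * k" "k > 0" by (auto elim!: evenE)
    define l where "l = nat (k - 1)"
    have l: "e = 2 * int l + 2" using k by (simp add: l_def)
    have n: "nat e = Suc (Suc (2 * l))" "nat (e - 1) = Suc (2 * l)" "(e - 1) div 2 = int l"
      "(e - 1 - 1) div 2 = int l" "e div 2 = int l + 1" using l by auto
    have a: "path_count y (e + 2 * int j + 1) j = (y + real l) gchoose Suc (Suc (2 * l))"
      using True by (simp add: pc n)
    have b: "path_count y ((e - 1) + 2 * int j + 1) j = (y + real l) gchoose Suc (2 * l)"
      using True unfolding pc by (simp only: n) simp
    have "(y + real l + 1) gchoose Suc (Suc (2 * l)) =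
        ((y + real l) gchoose Suc (2 * l)) + ((y + real l) gchoose Suc (Suc (2 * l)))"
      using gbinomial_Suc_Suc[of "y + real l" "Suc (2 * l)"] .
    moreover have "\<psi> e = (y + real l + 1) gchoose Suc (Suc (2 * l))"
      using True unfolding \<psi>_def n by (simp add: add.assoc)
    moreover have "step 1 {x. 2 \<le> x \<and> x \<le> 2 * int h \<and> odd x} (path_count y) (e + 2 * int j + 1) j =
        path_count y (e + 2 * int j + 1) j + path_count y ((e - 1) + 2 * int j + 1) j"
      using True that by (simp add: step_def)
    ultimately show ?thesis
      by (simp only: a b)
  next
    case False
    have sh: "e + 2 * int j + 1 - 1 = (e - 1) + 2 * int j + 1" by simp
    show ?thesis
    proof (cases "odd e")
      case True
      then have "(e - 1) div 2 = e div 2" by (auto elim!: oddE)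
      then show ?thesis
        using True pc[of y e] by (simp add: step_def \<psi>_def)
    next
      case even: False
      \<comment> \<open>Here the entry that the row operation could add is 0, so it does not matter
        that row 1 has no row above it.\<close>
      then have "e \<le> 0" using False by auto
      then have "path_count y ((e - 1) + 2 * int j + 1) j = 0"
        by (simp only: pc) simp
      moreover have "path_count y (e + 2 * int j + 1) j = \<psi> e"
        using \<open>e \<le> 0\<close> by (simp only: pc) (simp add: \<psi>_def)
      ultimately show ?thesis
        unfolding step_def by (simp only: sh) simp
    qed
  qed
  define G where "G = step 1 {x. 2 \<le> x \<and> x \<le> 2 * int h \<and> odd x} (path_count y)"
  have Gx: "G x j = \<psi> d"
    using first[of d] assms x by (simp add: G_def)
  have Gx1: "G (x - 1) j = \<psi> (d - 1)" if "2 \<le> x"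
  proof -
    have "x - 1 = (d - 1) + 2 * int j + 1" using x by simp
    then show ?thesis
      using first[of "d - 1"] assms that by (simp add: G_def)
  qed
  have sum: "step 1 {x. 2 \<le> x \<and> x \<le> 2 * int h \<and> even x} G x j =
      \<psi> d + (if odd d then \<psi> (d - 1) else 0)"
  proof (cases "odd d")
    case True
    then have "even x" using x by simp
    then have "2 \<le> x" using assms by presburger
    then show ?thesis
      using True assms \<open>even x\<close> Gx Gx1 by (simp add: step_def)
  next
    case False
    then have "odd x" using x by simp
    then show ?thesis using False Gx by (simp add: step_def)
  qed
  have "\<psi> d + (if odd d then \<psi> (d - 1) else 0) = path_count (y + 1) x j"
  proof (cases "odd d \<and> d > 0")
    case True
    then obtain k where k: "d = 2 * k + 1" by (auto elim!: oddE)
    have k0: "k \<ge> 0" using True k by auto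
    have "(y + 1 + of_int k) gchoose Suc (nat (2 * k)) =
        ((y + of_int k) gchoose nat (2 * k)) + ((y + of_int k) gchoose Suc (nat (2 * k)))"
      using gbinomial_Suc_Suc[of "y + of_int k" "nat (2 * k)"] by (simp add: algebra_simps)
    moreover have "nat (2 * k + 1) = Suc (nat (2 * k))" using k0 by simp
    moreover have "path_count (y + 1) x j = (y + 1 + of_int k) gchoose nat (2 * k + 1)"
      using pc[of "y + 1" d] x k k0 by simp
    ultimately show ?thesis
      using k k0 by (simp add: \<psi>_def)
  next
    case False
    show ?thesis
    proof (cases "d < 0")
      case d: False
      then have "even d" using False by presburger
      then obtain k where k: "d = 2 * k" by auto
      have "(d - 1) div 2 = k - 1" using k by auto
      then show ?thesis using pc[of "y + 1" d] x k d by (simp add: \<psi>_def)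
    qed (use pc[of "y + 1" d] x in \<open>simp add: \<psi>_def\<close>)
  qed
  with sum show ?thesis
    by (simp only: G_def)
qed

text \<open>For distance \<open>2 * k + 1\<close>, absorption gives (s + k) / (2 k + 1) times the
  entry above. This factor is 1/2 for all k if \<open>s = 1 / 2\<close>. If \<open>s = 1\<close> it
  is 1 at k = 0, and for k > 0 both entries vanish.\<close>

lemma path_count_even:
  assumes "s = 1 \<or> s = 1 / 2" "even x"
  shows "path_count s x j = s * path_count s (x - 1) j"
proof (cases "x - 2 * int j - 1 < 0")
  case False
  define d where "d = x - 2 * int j - 1"
  have "odd d" using assms(2) by (simp add: d_def)
  moreover from this have "d \<noteq> 0" by (metis dvd_0_right)
  ultimately have "odd d" "d > 0" using False by (auto simp: d_def)
  then obtain i where i: "d = 2 * i + 1" by (auto elim!: oddE)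
  define k where "k = nat i"
  have k: "d = 2 * int k + 1" using i \<open>d > 0\<close> by (simp add: k_def)
  have "(s + real k) gchoose Suc (2 * k) = s * ((s + real k - 1) gchoose (2 * k))"
  proof -
    have *: "(s + real k) gchoose Suc (2 * k) =
        (s + real k) / real (Suc (2 * k)) * ((s + real k - 1) gchoose (2 * k))"
      using gbinomial_absorption'[of "Suc (2 * k)" "s + real k"] by simp
    show ?thesis
    proof (cases "s = 1 \<and> k > 0")
      case True
      then have "real k gchoose (2 * k) = 0"
        by (metis binomial_eq_0 binomial_gbinomial less_add_same_cancel2 mult_2 of_nat_0)
      then show ?thesis using * True by simp
    next
      case False
      then have "(s + real k) / real (Suc (2 * k)) = s"
        using assms(1) by (elim disjE) (simp_all add: field_simps)
      then show ?thesis using * by simp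
    qed
  qed
  moreover have "nat (2 * int k + 1) = Suc (2 * k)" "nat (2 * int k) = 2 * k" by auto
  moreover have "path_count s x j = (s + real k) gchoose Suc (2 * k)"
    unfolding path_count_def Let_def d_def[symmetric] k using calculation by simp
  moreover have "path_count s (x - 1) j = (s + real k - 1) gchoose (2 * k)"
  proof -
    have d1: "x - 1 - 2 * int j - 1 = 2 * int k" using k d_def by simp
    have d2: "(2 * int k - 1) div 2 = int k - 1" by auto
    have "nat (2 * int k) = 2 * k" by simp
    then show ?thesis
      unfolding path_count_def Let_def d1 d2 by (simp add: add_diff_eq)
  qed
  ultimately show ?thesis by simp
qed (simp add: path_count_def)

section \<open>The particles at the eastern end\<close>

definition odd_rows :: "nat \<Rightarrow> int set" where
  "odd_rows h = {x. 1 \<le> x \<and> x \<le> 2 * int h \<and> odd x}"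

lemma odd_rows_image: "odd_rows h = (\<lambda>i. 2 * int i + 1) ` {..<h}"
proof (intro equalityI subsetI)
  fix x assume x: "x \<in> odd_rows h"
  then obtain k where k: "x = 2 * k + 1" by (auto simp: odd_rows_def elim!: oddE)
  then show "x \<in> (\<lambda>i. 2 * int i + 1) ` {..<h}"
    using x by (intro image_eqI[of _ _ "nat k"]) (auto simp: odd_rows_def)
qed (auto simp: odd_rows_def)

lemma finite_odd_rows: "finite (odd_rows h)"
  by (simp add: odd_rows_image)

lemma card_odd_rows: "card (odd_rows h) = h"
  by (simp add: odd_rows_image card_image inj_on_def)

lemma sorted_list_of_odd_rows: "sorted_list_of_set (odd_rows h) = map (\<lambda>i. 2 * int i + 1) [0..<h]"
proof (rule sorted_list_of_set_unique[THEN iffD1])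
  show "finite (odd_rows h)" by (rule finite_odd_rows)
  show "sorted_wrt (<) (map (\<lambda>i. 2 * int i + 1) [0..<h]) \<and>
      set (map (\<lambda>i. 2 * int i + 1) [0..<h]) = odd_rows h \<and>
      length (map (\<lambda>i. 2 * int i + 1) [0..<h]) = card (odd_rows h)"
    by (auto simp: sorted_wrt_iff_nth_less odd_rows_image card_odd_rows[unfolded odd_rows_image])
qed

text \<open>An even row in \<open>P\<close> is a zero row, and \<open>h\<close> odd rows are all of
  them. In that case the matrix is unitriangular: it has zeros where the distance is negative and
  ones where it is 0. The entries below the diagonal need not vanish, and at
  \<open>y = 1 / 2\<close> they do not, but they leave the determinant unchanged.\<close>

lemma minor_odd_path_count:
  assumes "P \<subseteq> {1..2 * int h}"
  shows "minor h (\<lambda>x j. if odd x then path_count y x j else 0) P = of_bool (P = odd_rows h)"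
proof (cases "card P = h")
  case True
  have fin: "finite P" using assms finite_subset by blast
  show ?thesis
  proof (cases "\<exists>x\<in>P. even x")
    case even: True
    then obtain x where x: "x \<in> P" "even x" by blast
    obtain k where k: "k < h" "sorted_list_of_set P ! k = x"
      using True fin x by (metis in_set_conv_nth length_sorted_list_of_set set_sorted_list_of_set)
    have "P \<noteq> odd_rows h" using x by (auto simp: odd_rows_def)
    moreover have "row_det h (\<lambda>i j. if odd (sorted_list_of_set P ! i)
        then path_count y (sorted_list_of_set P ! i) j else 0) = 0"
      using k x(2) by (intro row_det_zero_row[of k]) auto
    ultimately show ?thesis
      by (simp add: minor_def)
  next
    case False
    then have "P \<subseteq> odd_rows h" using assms by (auto simp: odd_rows_def)
    then have P: "P = odd_rows h"
      using True by (intro card_subset_eq) (auto simp: finite_odd_rows card_odd_rows)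
    have "row_det h (\<lambda>i j. if odd (sorted_list_of_set P ! i)
        then path_count y (sorted_list_of_set P ! i) j else 0) = 1" (is "?D = 1")
      by (rule row_det_unitriangular) (simp_all add: P sorted_list_of_odd_rows path_count_def)
    moreover have "minor h (\<lambda>x j. if odd x then path_count y x j else 0) P = ?D"
      using True by (simp add: minor_def)
    ultimately show ?thesis
      using P by (simp only: of_bool_eq simp_thms)
  qed
qed (auto simp: minor_def card_odd_rows)

text \<open>
  The matrix of \<open>path_count s\<close> with \<open>s = 1/2\<close> is that of single paths whose last step has weight
  1/2: this is where the shift by 1/2 comes from.
\<close>

lemma minor_path_count_init:
  assumes s: "s = 1 \<or> s = 1 / 2" and P: "P \<subseteq> {1..2 * int h}"
  shows "minor h (path_count s) P =
    (\<Sum>V\<in>Pow ({x. 2 \<le> x \<and> x \<le> 2 * int h \<and> even x} \<inter> movable P).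
       s ^ card V * of_bool (move V P = odd_rows h))"
proof -
  let ?A = "{x. 2 \<le> x \<and> x \<le> 2 * int h \<and> even x}"
  \<comment> \<open>The matrix after the last column, where no particle may be in an even row. By
    \<open>path_count_even\<close> one column of weight \<open>s\<close> restores the even
    rows.\<close>
  let ?f = "\<lambda>x j. if odd x then path_count s x j else 0"
  have fin: "finite P" using P finite_subset by blast
  have "?A \<subseteq> {1..2 * int h}" by auto
  then have "finite ?A" using finite_subset by blast
  have "minor h (path_count s) P = minor h (step s ?A ?f) P"
  proof (rule minor_cong[OF fin])
    fix x j assume "x \<in> P"
    then have "1 \<le> x" "x \<le> 2 * int h" using P by auto
    moreover have "x \<noteq> 1" if "even x" using that by auto
    ultimately show "path_count s x j = step s ?A ?f x j"
      using path_count_even[OF s, of x j] by (auto simp: step_def)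
  qed
  also have "\<dots> = (\<Sum>V\<in>Pow (?A \<inter> movable P). s ^ card V * minor h ?f (move V P))"
    using fin \<open>finite ?A\<close> by (intro minor_step) auto
  also have "\<dots> = (\<Sum>V\<in>Pow (?A \<inter> movable P). s ^ card V * of_bool (move V P = odd_rows h))"
  proof (rule sum.cong[OF refl])
    fix V assume "V \<in> Pow (?A \<inter> movable P)"
    then have "move V P \<subseteq> {1..2 * int h}" using P by (auto simp: move_def)
    then show "s ^ card V * minor h ?f (move V P) = s ^ card V * of_bool (move V P = odd_rows h)"
      by (simp only: minor_odd_path_count)
  qed
  finally show ?thesis .
qed

section \<open>Polynomial dependence on y\<close>

lemma minor_path_count_polynomial:
  "real_polynomial_function (\<lambda>y. minor h (path_count y) P)"
proof -
  have "real_polynomial_function (\<lambda>y. path_count y x j)" for x j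
  proof (cases "x - 2 * int j - 1 < 0")
    case False
    have "real_polynomial_function (\<lambda>y::real. (y + c) gchoose n)" for c n
    proof -
      have "real_polynomial_function (\<lambda>y::real. y + c - real i)" for i
        by (rule real_polynomial_function_diff real_polynomial_function.intros(3)
            real_polynomial_function.intros(1)[OF bounded_linear_ident]
            real_polynomial_function.intros(2))+
      then show ?thesis
        unfolding gbinomial_prod_rev
        by (rule real_polynomial_function_divide[OF real_polynomial_function_prod, rotated]) simp
    qed
    then show ?thesis using False by (simp add: path_count_def Let_def)
  qed (simp add: path_count_def real_polynomial_function.intros(2))
  then have "real_polynomial_function (\<lambda>y. row_det h (\<lambda>i. path_count y (sorted_list_of_set P ! i)))"
    unfolding row_det_sum
    by (intro real_polynomial_function_sum real_polynomial_function.intros(2,4)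
        real_polynomial_function_prod) (auto simp: finite_permutations)
  then show ?thesis
    by (cases "card P = h") (simp_all add: minor_def real_polynomial_function.intros(2))
qed

lemma real_polynomial_function_poly:
  fixes f :: "real \<Rightarrow> real"
  assumes "real_polynomial_function f"
  obtains g where "\<And>y. f y = poly g y"
proof -
  obtain a n where "f = (\<lambda>x. \<Sum>i\<le>n. a i * x ^ i)"
    using assms real_polynomial_function_iff_sum by blast
  then have "f y = poly (\<Sum>i\<le>n. monom (a i) i) y" for y
    by (simp add: poly_sum poly_monom)
  then show thesis by (rule that)
qed

section \<open>Tilings of unions\<close>

lemma finite_tilings: "finite X \<Longrightarrow> finite (tilings X)"
  using finitely_many_partition_on[of X] by (auto simp: tilings_def intro: finite_subset)

lemma tilings_iff:
  "T \<in> tilings X \<longleftrightarrow>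
     \<Union>T = X \<and> (\<forall>L\<in>T. lozenge L) \<and> (\<forall>L\<in>T. \<forall>L'\<in>T. L \<inter> L' \<noteq> {} \<longrightarrow> L = L')"
  by (auto simp: tilings_def partition_on_def pairwise_def disjnt_def lozenge_def)

lemma tilings_lozenge: "T \<in> tilings X \<Longrightarrow> L \<in> T \<Longrightarrow> lozenge L"
  by (auto simp: tilings_iff)

lemma tilings_Union: "T \<in> tilings X \<Longrightarrow> \<Union>T = X"
  by (auto simp: tilings_iff)

lemma tilings_unique:
  "T \<in> tilings X \<Longrightarrow> L \<in> T \<Longrightarrow> L' \<in> T \<Longrightarrow> t \<in> L \<Longrightarrow> t \<in> L' \<Longrightarrow> L = L'"
  by (auto simp: tilings_iff)

lemma finite_tiling: "finite X \<Longrightarrow> T \<in> tilings X \<Longrightarrow> finite T"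
  by (auto simp: tilings_def intro: finite_elements)

lemma M_cong:
  assumes "\<And>L. lozenge L \<Longrightarrow> L \<subseteq> X \<Longrightarrow> w L = w' L"
  shows "M w X = M w' X"
  unfolding M_def using assms by (intro sum.cong prod.cong) (auto simp: tilings_iff)

text \<open>
  If the lozenges across the border of \<open>X\<close> and \<open>Y\<close> are \<open>{\<alpha> r, \<beta> r}\<close> for \<open>r \<in> I\<close>, a tiling
  is given by the set \<open>S\<close> of those that it uses and tilings of what they leave of \<open>X\<close> and \<open>Y\<close>.
\<close>

lemma M_split:
  fixes I :: "'a set"
  assumes fin: "finite X" "finite Y" "finite I" and disj: "X \<inter> Y = {}"
    and inj: "inj_on \<alpha> I" "inj_on \<beta> I" and sub: "\<alpha> ` I \<subseteq> X" "\<beta> ` I \<subseteq> Y"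
    and loz: "\<And>r. r \<in> I \<Longrightarrow> lozenge {\<alpha> r, \<beta> r}"
    and cross: "\<And>L. lozenge L \<Longrightarrow> L \<subseteq> X \<union> Y \<Longrightarrow> \<not> L \<subseteq> X \<Longrightarrow> \<not> L \<subseteq> Y \<Longrightarrow> \<exists>r\<in>I. L = {\<alpha> r, \<beta> r}"
  shows "M w (X \<union> Y) =
    (\<Sum>S\<in>Pow I. (\<Prod>r\<in>S. w {\<alpha> r, \<beta> r}) * (M w (X - \<alpha> ` S) * M w (Y - \<beta> ` S)))"
proof -
  define K where "K = (\<lambda>S. (\<lambda>r. {\<alpha> r, \<beta> r}) ` S)"
  \<comment> \<open>The terms of the right-hand side, multiplied out, are indexed by
    \<open>D\<close>; \<open>join\<close> and \<open>cut\<close> are inverse bijections between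
    \<open>D\<close> and the tilings of the union.\<close>
  define D where "D = Sigma (Pow I) (\<lambda>S. tilings (X - \<alpha> ` S) \<times> tilings (Y - \<beta> ` S))"
  define join where "join = (\<lambda>(S, T1, T2). K S \<union> T1 \<union> T2)"
  define cut where "cut = (\<lambda>T. ({r\<in>I. {\<alpha> r, \<beta> r} \<in> T}, {L\<in>T. L \<subseteq> X}, {L\<in>T. L \<subseteq> Y}))"
  have ab: "\<alpha> r \<in> X" "\<beta> r \<in> Y" "\<alpha> r \<notin> Y" "\<beta> r \<notin> X" if "r \<in> I" for r
    using sub disj that by auto
  have ne: "L \<noteq> {}" if "T \<in> tilings Z" "L \<in> T" for T Z L
    using that by (auto simp: tilings_iff lozenge_def)
  have injK: "{\<alpha> r, \<beta> r} = {\<alpha> r', \<beta> r'} \<longleftrightarrow> r = r'" if "r \<in> I" "r' \<in> I" for r r'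
    using that inj(1) ab by (metis doubleton_eq_iff inj_onD)
  have D: "S \<subseteq> I \<and> T1 \<in> tilings (X - \<alpha> ` S) \<and> T2 \<in> tilings (Y - \<beta> ` S)" if "(S, T1, T2) \<in> D" for S T1 T2
    using that by (auto simp: D_def)
  have parts: "L \<subseteq> X - \<alpha> ` S" if "T \<in> tilings (X - \<alpha> ` S)" "L \<in> T" for L T S
    using that by (auto simp: tilings_iff)
  have parts': "L \<subseteq> Y - \<beta> ` S" if "T \<in> tilings (Y - \<beta> ` S)" "L \<in> T" for L T S
    using that by (auto simp: tilings_iff)
  have sub1: "L \<subseteq> X - \<alpha> ` S \<and> L \<noteq> {}" if "(S, T1, T2) \<in> D" "L \<in> T1" for S T1 T2 L
    using D[OF that(1)] that(2) parts ne by metis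
  have sub2: "L \<subseteq> Y - \<beta> ` S \<and> L \<noteq> {}" if "(S, T1, T2) \<in> D" "L \<in> T2" for S T1 T2 L
    using D[OF that(1)] that(2) parts' ne by metis
  have notin: "\<not> L \<subseteq> X \<and> \<not> L \<subseteq> Y" if "S \<subseteq> I" "L \<in> K S" for S L
    using that ab unfolding K_def by blast
  have disjoint: "K S \<inter> T1 = {}" "K S \<inter> T2 = {}" "T1 \<inter> T2 = {}" if "(S, T1, T2) \<in> D" for S T1 T2
  proof -
    note d = D[OF that]
    show "K S \<inter> T1 = {}" using notin[of S] sub1[OF that] d by blast
    show "K S \<inter> T2 = {}" using notin[of S] sub2[OF that] d by blast
    show "T1 \<inter> T2 = {}" using sub1[OF that] sub2[OF that] disj by blast
  qed
  have join: "join x \<in> tilings (X \<union> Y)" if x: "x \<in> D" for x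
  proof -
    obtain S T1 T2 where xe: "x = (S, T1, T2)" by (cases x)
    note d = D[OF x[unfolded xe]]
    have U: "\<Union>T1 = X - \<alpha> ` S" "\<Union>T2 = Y - \<beta> ` S" "\<Union>(K S) = \<alpha> ` S \<union> \<beta> ` S"
      using d tilings_Union by (auto simp: K_def)
    have "\<Union>(join x) = X \<union> Y"
    proof -
      have "\<alpha> ` S \<subseteq> X" "\<beta> ` S \<subseteq> Y" using d sub by blast+
      then show ?thesis unfolding join_def xe prod.case Union_Un_distrib U by blast
    qed
    moreover have "lozenge L" if "L \<in> join x" for L
    proof -
      have "lozenge L" if "L \<in> K S" using that d loz unfolding K_def by blast
      then show ?thesis using that d tilings_lozenge unfolding join_def xe prod.case by blast
    qed
    moreover have "L = L'" if LL: "L \<in> join x" "L' \<in> join x" "L \<inter> L' \<noteq> {}" for L L'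
    proof -
      have inK: "\<exists>r\<in>S. L = {\<alpha> r, \<beta> r} \<and> (t = \<alpha> r \<or> t = \<beta> r)" if "L \<in> K S" "t \<in> L" for t L
        using that unfolding K_def by blast
      have in1: "t \<in> X \<and> t \<notin> \<alpha> ` S" if "L \<in> T1" "t \<in> L" for t L
        using parts[of T1 S L] d that by blast
      have in2: "t \<in> Y \<and> t \<notin> \<beta> ` S" if "L \<in> T2" "t \<in> L" for t L
        using parts'[of T2 S L] d that by blast
      have cases: "L \<in> K S \<or> L \<in> T1 \<or> L \<in> T2" if "L \<in> join x" for L
        using that unfolding join_def xe prod.case by blast
      obtain t where t: "t \<in> L" "t \<in> L'" using LL(3) by blast
      have "L = L' \<or> L' \<notin> K S" if LK: "L \<in> K S" and t: "t \<in> L" "t \<in> L'" for L L' t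
      proof (rule disjCI)
        assume "\<not> L' \<notin> K S"
        then obtain r r' where r: "r \<in> S" "L = {\<alpha> r, \<beta> r}" "t = \<alpha> r \<or> t = \<beta> r"
          and r': "r' \<in> S" "L' = {\<alpha> r', \<beta> r'}" "t = \<alpha> r' \<or> t = \<beta> r'"
          using inK[OF LK t(1)] inK[of L' t] t(2) by blast
        have rI: "r \<in> I" "r' \<in> I" using d r r' by auto
        have "\<alpha> r = \<alpha> r' \<or> \<beta> r = \<beta> r'" using r(3) r'(3) ab[OF rI(1)] ab[OF rI(2)] by metis
        then have "r = r'" using inj rI by (meson inj_onD)
        then show "L = L'" using r r' by simp
      qed
      moreover have "L \<notin> T1 \<and> L \<notin> T2" if LK: "L' \<in> K S" "t \<in> L" "t \<in> L'" for L L' t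
      proof -
        obtain r where r: "r \<in> S" "t = \<alpha> r \<or> t = \<beta> r" using inK[OF LK(1,3)] by blast
        then have "r \<in> I" using d by auto
        then show ?thesis
          using r ab[of r] in1[of L t] in2[of L t] LK(2) by (metis imageI)
      qed
      moreover have "\<not> (L \<in> T1 \<and> L' \<in> T2)" if "t \<in> L" "t \<in> L'" for L L' t
        using in1[of L t] in2[of L' t] that disj by blast
      moreover have "L = L'" if "L \<in> T1" "L' \<in> T1"
        using tilings_unique[of T1 _ L L' t] d that t by blast
      moreover have "L = L'" if "L \<in> T2" "L' \<in> T2"
        using tilings_unique[of T2 _ L L' t] d that t by blast
      ultimately show ?thesis
        using cases[OF LL(1)] cases[OF LL(2)] t by metis
    qed
    ultimately show ?thesis unfolding tilings_iff by blast
  qed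
  have cut_join: "cut (join x) = x" if x: "x \<in> D" for x
  proof -
    obtain S T1 T2 where xe: "x = (S, T1, T2)" by (cases x)
    note d = D[OF x[unfolded xe]]
    have nK: "{\<alpha> r, \<beta> r} \<notin> T1" "{\<alpha> r, \<beta> r} \<notin> T2" if "r \<in> I" for r
      using sub1[OF x[unfolded xe]] sub2[OF x[unfolded xe]] ab[OF that] by blast+
    have "{r\<in>I. {\<alpha> r, \<beta> r} \<in> join x} = S"
      using d nK injK by (auto simp: join_def xe K_def)
    moreover have "{L\<in>join x. L \<subseteq> X} = T1"
    proof -
      have "\<not> L \<subseteq> X" if "L \<in> K S" for L using notin[of S L] that d by blast
      moreover have "\<not> L \<subseteq> X" if "L \<in> T2" for L
        using sub2[OF x[unfolded xe] that] disj by blast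
      moreover have "L \<subseteq> X" if "L \<in> T1" for L using sub1[OF x[unfolded xe] that] by blast
      ultimately show ?thesis unfolding join_def xe prod.case by blast
    qed
    moreover have "{L\<in>join x. L \<subseteq> Y} = T2"
    proof -
      have "\<not> L \<subseteq> Y" if "L \<in> K S" for L using notin[of S L] that d by blast
      moreover have "\<not> L \<subseteq> Y" if "L \<in> T1" for L
        using sub1[OF x[unfolded xe] that] disj by blast
      moreover have "L \<subseteq> Y" if "L \<in> T2" for L using sub2[OF x[unfolded xe] that] by blast
      ultimately show ?thesis unfolding join_def xe prod.case by blast
    qed
    ultimately show ?thesis by (simp add: cut_def xe)
  qed
  have cut: "cut T \<in> D \<and> join (cut T) = T" if T: "T \<in> tilings (X \<union> Y)" for T
  proof
    define S where "S = {r\<in>I. {\<alpha> r, \<beta> r} \<in> T}"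
    define T1 where "T1 = {L\<in>T. L \<subseteq> X}"
    define T2 where "T2 = {L\<in>T. L \<subseteq> Y}"
    have c: "cut T = (S, T1, T2)" by (simp add: cut_def S_def T1_def T2_def)
    have U: "\<Union>T = X \<union> Y" and l: "\<And>L. L \<in> T \<Longrightarrow> lozenge L"
      and u: "\<And>L L'. L \<in> T \<Longrightarrow> L' \<in> T \<Longrightarrow> L \<inter> L' \<noteq> {} \<Longrightarrow> L = L'"
      using T by (auto simp: tilings_iff)
    \<comment> \<open>Here \<open>cross\<close> enters: a lozenge inside neither \<open>X\<close>
      nor \<open>Y\<close> is one of those indexed by \<open>I\<close>.\<close>
    have all: "L \<in> K S \<or> L \<in> T1 \<or> L \<in> T2" if "L \<in> T" for L
      using that cross[OF l[OF that]] U by (auto simp: K_def S_def T1_def T2_def)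
    then show "join (cut T) = T"
      unfolding c join_def by (auto simp: K_def S_def T1_def T2_def)
    have S: "S \<subseteq> I" by (auto simp: S_def)
    have 1: "\<Union>T1 = X - \<alpha> ` S"
    proof (intro equalityI subsetI)
      fix t assume "t \<in> \<Union>T1"
      then obtain L where L: "L \<in> T" "L \<subseteq> X" "t \<in> L" by (auto simp: T1_def)
      have "t \<noteq> \<alpha> r" if "r \<in> S" for r
        using u[of L "{\<alpha> r, \<beta> r}"] L that ab[of r] by (auto simp: S_def)
      then show "t \<in> X - \<alpha> ` S" using L by auto
    next
      fix t assume t: "t \<in> X - \<alpha> ` S"
      then obtain L where L: "L \<in> T" "t \<in> L" using U by blast
      have "L \<notin> K S" using L t S ab unfolding K_def by blast
      moreover have "L \<notin> T2" using L t disj by (auto simp: T2_def)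
      ultimately show "t \<in> \<Union>T1" using all[OF L(1)] L by auto
    qed
    have 2: "\<Union>T2 = Y - \<beta> ` S"
    proof (intro equalityI subsetI)
      fix t assume "t \<in> \<Union>T2"
      then obtain L where L: "L \<in> T" "L \<subseteq> Y" "t \<in> L" by (auto simp: T2_def)
      have "t \<noteq> \<beta> r" if "r \<in> S" for r
        using u[of L "{\<alpha> r, \<beta> r}"] L that ab[of r] by (auto simp: S_def)
      then show "t \<in> Y - \<beta> ` S" using L by auto
    next
      fix t assume t: "t \<in> Y - \<beta> ` S"
      then obtain L where L: "L \<in> T" "t \<in> L" using U by blast
      have "L \<notin> K S" using L t S ab unfolding K_def by blast
      moreover have "L \<notin> T1" using L t disj by (auto simp: T1_def)
      ultimately show "t \<in> \<Union>T2" using all[OF L(1)] L by auto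
    qed
    show "cut T \<in> D"
      unfolding c D_def using S 1 2 l u by (auto simp: tilings_iff T1_def T2_def)
  qed
  have "M w (X \<union> Y) = (\<Sum>x\<in>D. \<Prod>L\<in>join x. w L)"
    unfolding M_def
    by (rule sum.reindex_bij_witness[of _ join cut]) (use join cut cut_join in auto)
  also have "\<dots> = (\<Sum>(S, T1, T2)\<in>D. (\<Prod>r\<in>S. w {\<alpha> r, \<beta> r}) * ((\<Prod>L\<in>T1. w L) * (\<Prod>L\<in>T2. w L)))"
  proof (rule sum.cong[OF refl], clarify)
    fix S T1 T2 assume x: "(S, T1, T2) \<in> D"
    note d = D[OF x] and dj = disjoint[OF x]
    have f: "finite T1" "finite T2" "finite (K S)"
      using d fin finite_tiling[of "X - \<alpha> ` S" T1] finite_tiling[of "Y - \<beta> ` S" T2]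
      by (auto simp: K_def intro: finite_subset)
    have "(\<Prod>L\<in>K S. w L) = (\<Prod>r\<in>S. w {\<alpha> r, \<beta> r})"
      unfolding K_def using injK d by (subst prod.reindex) (auto simp: inj_on_def)
    moreover have "(\<Prod>L\<in>K S \<union> (T1 \<union> T2). w L) = (\<Prod>L\<in>K S. w L) * ((\<Prod>L\<in>T1. w L) * (\<Prod>L\<in>T2. w L))"
      using f dj by (simp add: prod.union_disjoint Int_Un_distrib)
    ultimately show "prod w (join (S, T1, T2)) = (\<Prod>r\<in>S. w {\<alpha> r, \<beta> r}) * ((\<Prod>L\<in>T1. w L) * (\<Prod>L\<in>T2. w L))"
      by (simp add: join_def Un_assoc)
  qed
  also have "\<dots> = (\<Sum>S\<in>Pow I. \<Sum>(T1, T2)\<in>tilings (X - \<alpha> ` S) \<times> tilings (Y - \<beta> ` S).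
      (\<Prod>r\<in>S. w {\<alpha> r, \<beta> r}) * ((\<Prod>L\<in>T1. w L) * (\<Prod>L\<in>T2. w L)))"
    unfolding D_def using fin by (subst sum.Sigma) (auto simp: finite_tilings)
  also have "\<dots> = (\<Sum>S\<in>Pow I. (\<Prod>r\<in>S. w {\<alpha> r, \<beta> r}) * (M w (X - \<alpha> ` S) * M w (Y - \<beta> ` S)))"
  proof -
    have "M w X' * M w Y' = (\<Sum>(T1, T2)\<in>tilings X' \<times> tilings Y'. (\<Prod>L\<in>T1. w L) * (\<Prod>L\<in>T2. w L))"
      for X' Y'
      by (simp only: M_def sum_product sum.cartesian_product)
    then show ?thesis
      by (simp add: sum_distrib_left case_prod_unfold)
  qed
  finally show ?thesis .
qed

text \<open>When the possible lozenges are pairwise disjoint, every set of them tiles its own union,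
  so covering \<open>X\<close> is the only condition. This is the situation inside a single
  column.\<close>

lemma M_rigid:
  assumes fin: "finite X" and inj: "inj_on \<gamma> A" "finite A"
    and loz: "\<And>L. L \<subseteq> X \<Longrightarrow> lozenge L \<longleftrightarrow> (\<exists>x\<in>A. L = \<gamma> x)"
    and disj: "\<And>x y. x \<in> A \<Longrightarrow> y \<in> A \<Longrightarrow> \<gamma> x \<inter> \<gamma> y \<noteq> {} \<Longrightarrow> x = y"
  shows "M w X = (\<Sum>V\<in>Pow A. (\<Prod>x\<in>V. w (\<gamma> x)) * of_bool (\<Union>(\<gamma> ` V) = X))"
proof -
  define J where "J = {V\<in>Pow A. \<Union>(\<gamma> ` V) = X}"
  have tile: "\<gamma> ` V \<in> tilings X" if V: "V \<in> J" for V
  proof -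
    have VA: "V \<subseteq> A" and U: "\<Union>(\<gamma> ` V) = X" using V by (auto simp: J_def)
    have "lozenge (\<gamma> x)" if "x \<in> V" for x
      using loz[of "\<gamma> x"] VA U that by blast
    moreover have "\<gamma> x = \<gamma> y" if "x \<in> V" "y \<in> V" "\<gamma> x \<inter> \<gamma> y \<noteq> {}" for x y
      using disj[of x y] VA that by blast
    ultimately show ?thesis
      using U unfolding tilings_iff by blast
  qed
  have untile: "{x\<in>A. \<gamma> x \<in> T} \<in> J \<and> \<gamma> ` {x\<in>A. \<gamma> x \<in> T} = T" if T: "T \<in> tilings X" for T
  proof -
    have "\<exists>x\<in>A. L = \<gamma> x" if "L \<in> T" for L
      using that tilings_lozenge[OF T that] tilings_Union[OF T] loz[of L] by blast
    then have *: "\<gamma> ` {x\<in>A. \<gamma> x \<in> T} = T" by blast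
    then have "{x\<in>A. \<gamma> x \<in> T} \<in> J"
      using tilings_Union[OF T] by (simp add: J_def)
    then show ?thesis using * by simp
  qed
  have injV: "inj_on \<gamma> V" if "V \<in> J" for V
    using inj_on_subset[OF inj(1)] that by (simp add: J_def)
  have preimage: "{x\<in>A. \<gamma> x \<in> \<gamma> ` V} = V" if "V \<in> J" for V
    using inj_on_image_mem_iff[OF inj(1)] that by (auto simp: J_def)
  have "M w X = (\<Sum>V\<in>J. \<Prod>L\<in>\<gamma> ` V. w L)"
    unfolding M_def
    by (rule sum.reindex_bij_witness[of _ "\<lambda>V. \<gamma> ` V" "\<lambda>T. {x\<in>A. \<gamma> x \<in> T}"])
      (use tile untile preimage in blast, use untile in blast, use preimage in blast,
       use tile in blast, use untile in auto)
  also have "\<dots> = (\<Sum>V\<in>J. \<Prod>x\<in>V. w (\<gamma> x))"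
    by (rule sum.cong[OF refl]) (simp add: prod.reindex[OF injV])
  also have "\<dots> = (\<Sum>V\<in>Pow A. (\<Prod>x\<in>V. w (\<gamma> x)) * of_bool (\<Union>(\<gamma> ` V) = X))"
    using inj(2) unfolding J_def
    by (subst sum.inter_filter) (simp, intro sum.cong[OF refl], simp)
  finally show ?thesis .
qed

section \<open>Rows and columns of triangles\<close>

text \<open>
  \<open>tri p q r c\<close> lies in row \<open>r\<close>, counted downwards from 1 at the top of the tube, and in column
  \<open>c\<close>, counted eastwards from 1 at its western boundary.
\<close>

definition tri :: "int \<Rightarrow> int \<Rightarrow> int \<Rightarrow> int \<Rightarrow> triangle" where
  "tri p q r c = (if even (r + c) then Up else Down) (p + (c + r) div 2) (q - r)"

lemma tri_inject: "tri p q r c = tri p q r' c' \<longleftrightarrow> r = r' \<and> c = c'"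
proof
  assume eq: "tri p q r c = tri p q r' c'"
  then have r: "r = r'" and d: "(c + r) div 2 = (c' + r') div 2" and e: "even (r + c) = even (r' + c')"
    by (auto simp: tri_def split: if_splits)
  have "(c + r) mod 2 = (c' + r') mod 2"
    using e by (simp add: add.commute mod2_eq_if)
  then have "c + r = c' + r'"
    using d by (metis div_mult_mod_eq)
  with r show "r = r' \<and> c = c'" by simp
qed simp

lemma tri_cases:
  obtains r c where "t = tri p q r c"
proof (cases t)
  case (Up i j)
  then have "t = tri p q (q - j) (2 * (i - p) - (q - j))" by (simp add: tri_def)
  then show thesis by (rule that)
next
  case (Down i j)
  then have "t = tri p q (q - j) (2 * (i - p) - (q - j) + 1)" by (simp add: tri_def)
  then show thesis by (rule that)
qed

text \<open>\<open>2 * i + j\<close> is the doubled abscissa of a vertex. Relative to (p, q), the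
  horizontal side of a triangle of column \<open>c\<close> runs from \<open>c\<close> to
  \<open>c + 2\<close> and its opposite vertex is at \<open>c + 1\<close>; the parity test tells on
  which of the two lines the side lies.\<close>

lemma verts_tri_iff:
  "(i, j) \<in> verts (tri p q r c) \<longleftrightarrow>
     (if even (r + c) \<longleftrightarrow> j = q - r then 2 * i + j = 2 * p + q + c \<or> 2 * i + j = 2 * p + q + c + 2
      else 2 * i + j = 2 * p + q + c + 1) \<and> (j = q - r \<or> j = q - r + 1)"
proof (cases "even (r + c)")
  case True
  then obtain k where k: "c + r = 2 * k" by (metis add.commute evenE)
  then have c: "c = 2 * k - r" by simp
  show ?thesis unfolding c tri_def by auto
next
  case False
  then obtain k where k: "c + r = 2 * k + 1" by (metis add.commute oddE)
  then have c: "c = 2 * k + 1 - r" by simp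
  show ?thesis unfolding c tri_def by auto
qed

lemma two_subsets_of_three:
  assumes "a \<noteq> b" "b \<noteq> c" "a \<noteq> c"
  shows "{e. e \<subseteq> {a, b, c} \<and> card e = 2} = {{a, b}, {b, c}, {a, c}}"
proof (intro equalityI subsetI)
  fix e assume "e \<in> {e. e \<subseteq> {a, b, c} \<and> card e = 2}"
  then obtain x y where e: "e = {x, y}" "x \<noteq> y" and mem: "x \<in> {a, b, c}" "y \<in> {a, b, c}"
    by (auto simp: card_2_iff)
  from mem show "e \<in> {{a, b}, {b, c}, {a, c}}"
    unfolding e(1) using e(2) by (elim insertE emptyE) (simp_all add: insert_commute)
next
  fix e assume "e \<in> {{a, b}, {b, c}, {a, c}}"
  then show "e \<in> {e. e \<subseteq> {a, b, c} \<and> card e = 2}"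
    using assms by (elim insertE emptyE) simp_all
qed

lemma edges_Up:
  "edges (Up i j) = {{(i, j), (i + 1, j)}, {(i + 1, j), (i, j + 1)}, {(i, j), (i, j + 1)}}"
  unfolding edges_def verts.simps by (rule two_subsets_of_three) simp_all

lemma edges_Down:
  "edges (Down i j) = {{(i, j + 1), (i + 1, j + 1)}, {(i + 1, j + 1), (i + 1, j)}, {(i, j + 1), (i + 1, j)}}"
  unfolding edges_def verts.simps by (rule two_subsets_of_three) simp_all

lemma Int_nonempty_iff_bex: "A \<inter> B \<noteq> {} \<longleftrightarrow> (\<exists>x\<in>A. x \<in> B)"
  by blast

lemma edges_Up_Int_Up: "edges (Up i j) \<inter> edges (Up k l) \<noteq> {} \<longleftrightarrow> i = k \<and> j = l"
  unfolding Int_nonempty_iff_bex edges_Up by (simp add: doubleton_eq_iff) presburger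

lemma edges_Down_Int_Down: "edges (Down i j) \<inter> edges (Down k l) \<noteq> {} \<longleftrightarrow> i = k \<and> j = l"
  unfolding Int_nonempty_iff_bex edges_Down by (simp add: doubleton_eq_iff) presburger

lemma edges_Up_Int_Down:
  "edges (Up i j) \<inter> edges (Down k l) \<noteq> {} \<longleftrightarrow> (k = i \<or> k = i - 1) \<and> l = j \<or> k = i \<and> l = j - 1"
  unfolding Int_nonempty_iff_bex edges_Up edges_Down by (simp add: doubleton_eq_iff) presburger

text \<open>For \<open>r + c\<close> even the triangle points upwards and its horizontal neighbour
  across an edge is the one below; otherwise it is the one above.\<close>

definition adjacent :: "int \<Rightarrow> int \<Rightarrow> int \<Rightarrow> int \<Rightarrow> bool" where
  "adjacent r c r' c' \<longleftrightarrow> r' = r \<and> (c' = c + 1 \<or> c' = c - 1) \<or>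
     c' = c \<and> (even (r + c) \<and> r' = r + 1 \<or> odd (r + c) \<and> r' = r - 1)"

lemma edges_tri_Int:
  "tri p q r c \<noteq> tri p q r' c' \<and> edges (tri p q r c) \<inter> edges (tri p q r' c') \<noteq> {} \<longleftrightarrow>
     adjacent r c r' c'"
proof -
  \<comment> \<open>Writing the columns as an even or odd number minus the row removes both the
    \<open>if\<close> and the \<open>div\<close> from \<open>tri\<close>.\<close>
  consider (1) k l where "c = 2 * k - r" "c' = 2 * l - r'" | (2) k l where "c = 2 * k - r" "c' = 2 * l + 1 - r'"
    | (3) k l where "c = 2 * k + 1 - r" "c' = 2 * l - r'" | (4) k l where "c = 2 * k + 1 - r" "c' = 2 * l + 1 - r'"
  proof -
    have "\<exists>k. c = 2 * k - r \<or> c = 2 * k + 1 - r" "\<exists>k. c' = 2 * k - r' \<or> c' = 2 * k + 1 - r'" by presburger+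
    then show thesis using that by metis
  qed
  then show ?thesis
  proof cases
    case 1
    then show ?thesis
      by (auto simp: tri_def edges_Up_Int_Up adjacent_def; presburger)
  next
    case 2
    then show ?thesis
      by (auto simp: tri_def edges_Up_Int_Down adjacent_def; presburger)
  next
    case 3
    then show ?thesis
      by (auto simp: tri_def edges_Up_Int_Down Int_commute[of "edges (Down _ _)"] adjacent_def; presburger)
  next
    case 4
    then show ?thesis
      by (auto simp: tri_def edges_Down_Int_Down adjacent_def; presburger)
  qed
qed

lemma lozenge_tri_iff: "lozenge {tri p q r c, tri p q r' c'} \<longleftrightarrow> adjacent r c r' c'"
proof
  assume "lozenge {tri p q r c, tri p q r' c'}"
  then obtain s t where st: "s \<noteq> t" "edges s \<inter> edges t \<noteq> {}" "{tri p q r c, tri p q r' c'} = {s, t}"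
    by (auto simp: lozenge_def)
  then have "s = tri p q r c \<and> t = tri p q r' c' \<or> s = tri p q r' c' \<and> t = tri p q r c"
    by (metis doubleton_eq_iff)
  then show "adjacent r c r' c'"
    using st edges_tri_Int[of p q r c r' c'] by (metis Int_commute)
next
  assume "adjacent r c r' c'"
  then show "lozenge {tri p q r c, tri p q r' c'}"
    using edges_tri_Int[of p q r c r' c'] unfolding lozenge_def by blast
qed

lemma lozenge_cases:
  assumes "lozenge L"
  obtains (horizontal) r c where "L = {tri p q r c, tri p q r (c + 1)}"
    | (vertical) r c where "even (r + c)" "L = {tri p q r c, tri p q (r + 1) c}"
proof -
  obtain s t where "L = {s, t}" using assms by (auto simp: lozenge_def)
  moreover obtain r c r' c' where "s = tri p q r c" "t = tri p q r' c'"
    by (metis tri_cases)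
  ultimately have L: "L = {tri p q r c, tri p q r' c'}" by simp
  then have "adjacent r c r' c'" using assms lozenge_tri_iff by simp
  then consider "r' = r" "c' = c + 1" | "r' = r" "c' = c - 1" | "c' = c" "even (r + c)" "r' = r + 1"
    | "c' = c" "odd (r + c)" "r' = r - 1"
    unfolding adjacent_def by blast
  then show thesis
  proof cases
    case 1 then show thesis using L horizontal by blast
  next
    case 2
    then have "L = {tri p q r c', tri p q r (c' + 1)}" using L by auto
    then show thesis by (rule horizontal)
  next
    case 3 then show thesis using L vertical by blast
  next
    case 4
    then have "even (r' + c)" "L = {tri p q r' c, tri p q (r' + 1) c}" using L by auto
    then show thesis by (rule vertical)
  qed
qed

section \<open>The tube in row and column coordinates\<close>

lemma convex_rectangle: "convex (rectangle p q a h)"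
  unfolding rectangle_def by (auto simp: Let_def split: prod.split intro: convex_Times)

lemma face_subset_convex:
  assumes "convex C"
  shows "face V \<subseteq> C \<longleftrightarrow> (\<forall>v\<in>V. point v \<in> C)"
  unfolding face_def using hull_minimal[of "point ` V" C convex] hull_subset[of "point ` V" convex] assms
  by blast

lemma point_in_rectangle_half_iff:
  "point (i, j) \<in> rectangle p q (real n / 2) h \<longleftrightarrow>
     2 * p + q + 1 \<le> 2 * i + j \<and> 2 * i + j \<le> 2 * p + q + int n + 2 \<and> q - 2 * int h \<le> j \<and> j \<le> q"
  unfolding point_in_rectangle_iff by linarith

text \<open>By convexity only vertices need testing: column \<open>c\<close> occupies doubled
  abscissae from \<open>c\<close> to \<open>c + 2\<close>, the rectangle those from 1 to
  \<open>n + 2\<close>.\<close>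

lemma tube_eq:
  "tube p q (real n / 2) h = {tri p q r c |r c. 1 \<le> r \<and> r \<le> 2 * int h \<and> 1 \<le> c \<and> c \<le> int n}"
proof -
  have *: "tri p q r c \<in> tube p q (real n / 2) h \<longleftrightarrow> 1 \<le> r \<and> r \<le> 2 * int h \<and> 1 \<le> c \<and> c \<le> int n" for r c
  proof (cases "even (r + c)")
    case True
    then obtain k where k: "c + r = 2 * k" by (metis add.commute evenE)
    then have c: "c = 2 * k - r" by simp
    show ?thesis
      unfolding tube_def mem_Collect_eq face_subset_convex[OF convex_rectangle] c tri_def
      by (auto simp: point_in_rectangle_half_iff)
  next
    case False
    then obtain k where k: "c + r = 2 * k + 1" by (metis add.commute oddE)
    then have c: "c = 2 * k + 1 - r" by simp
    show ?thesis
      unfolding tube_def mem_Collect_eq face_subset_convex[OF convex_rectangle] c tri_def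
      by (auto simp: point_in_rectangle_half_iff)
  qed
  show ?thesis
  proof (rule Set.set_eqI)
    fix t
    obtain r c where t: "t = tri p q r c" by (rule tri_cases)
    show "t \<in> tube p q (real n / 2) h \<longleftrightarrow>
        t \<in> {tri p q r c |r c. 1 \<le> r \<and> r \<le> 2 * int h \<and> 1 \<le> c \<and> c \<le> int n}"
      unfolding t * mem_Collect_eq tri_inject by blast
  qed
qed

lemma tri_in_tube:
  "tri p q r c \<in> tube p q (real n / 2) h \<longleftrightarrow> 1 \<le> r \<and> r \<le> 2 * int h \<and> 1 \<le> c \<and> c \<le> int n"
  by (auto simp: tube_eq tri_inject)

section \<open>How the core can touch the tube\<close>

lemma point_in_area: "t \<in> R \<Longrightarrow> v \<in> verts t \<Longrightarrow> point v \<in> area R"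
  unfolding area_def face_def by (meson UN_I hull_inc imageI)

lemma finite_if_bounded_area:
  assumes "bounded (area R)"
  shows "finite R"
proof -
  obtain B where B: "\<And>x. x \<in> area R \<Longrightarrow> norm x \<le> B"
    using assms by (auto simp: bounded_iff)
  \<comment> \<open>As sqrt 3 is at least 1, |j| / 2 is at most the ordinate in absolute value,
    hence at most \<open>B\<close>; then |i| is at most B + |j| / 2. So \<open>2 * B\<close> bounds
    both indices.\<close>
  define N where "N = \<lceil>2 * B\<rceil>"
  have bound: "i \<in> {-N..N} \<and> j \<in> {-N..N}" if "t \<in> R" "(i, j) \<in> verts t" for t i j
  proof -
    have n: "norm (point (i, j)) \<le> B" by (rule B[OF point_in_area[OF that]])
    have "norm (fst (point (i, j))) \<le> norm (point (i, j))" "norm (snd (point (i, j))) \<le> norm (point (i, j))"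
      using norm_fst_le[of "fst (point (i, j))" "snd (point (i, j))"]
        norm_snd_le[of "snd (point (i, j))" "fst (point (i, j))"] by simp_all
    then have "norm (fst (point (i, j))) \<le> B" "norm (snd (point (i, j))) \<le> B"
      using n by linarith+
    then have "\<bar>of_int i + of_int j / 2\<bar> \<le> B" "\<bar>of_int j * sqrt 3 / 2\<bar> \<le> B"
      by (simp_all only: point_def fst_conv snd_conv real_norm_def)
    moreover have "\<bar>of_int j / 2 :: real\<bar> \<le> \<bar>of_int j * sqrt 3 / 2\<bar>"
    proof -
      have "\<bar>of_int j / 2 :: real\<bar> * 1 \<le> \<bar>of_int j / 2\<bar> * sqrt 3"
        by (rule mult_left_mono) simp_all
      then show ?thesis by (simp add: abs_mult)
    qed
    ultimately have "\<bar>of_int i\<bar> \<le> 2 * B" "\<bar>of_int j\<bar> \<le> 2 * B"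
      by linarith+
    then have "\<bar>i\<bar> \<le> N" "\<bar>j\<bar> \<le> N"
      unfolding N_def by linarith+
    then show ?thesis by auto
  qed
  define U where "U = {-N..N} \<times> {-N..N}"
  have "R \<subseteq> (\<lambda>v. Up (fst v) (snd v)) ` U \<union> (\<lambda>v. Down (fst v - 1) (snd v)) ` U"
  proof
    fix t assume t: "t \<in> R"
    show "t \<in> (\<lambda>v. Up (fst v) (snd v)) ` U \<union> (\<lambda>v. Down (fst v - 1) (snd v)) ` U"
    proof (cases t)
      case (Up i j)
      then have "(i, j) \<in> U" using bound[OF t, of i j] by (simp add: U_def)
      then show ?thesis using Up by (intro UnI1 image_eqI[of _ _ "(i, j)"]) simp_all
    next
      case (Down i j)
      then have "(i + 1, j) \<in> U" using bound[OF t, of "i + 1" j] by (simp add: U_def)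
      then show ?thesis using Down by (intro UnI2 image_eqI[of _ _ "(i + 1, j)"]) simp_all
    qed
  qed
  moreover have "finite U" by (simp add: U_def)
  ultimately show ?thesis by (meson finite_UnI finite_imageI finite_subset)
qed

text \<open>Turns the planar condition on the core into arithmetic. A common vertex lies on an edge
  of the western boundary, the ends of such an edge satisfy the bound, and a half-plane is
  convex.\<close>

lemma tubey_core_common_vertex:
  assumes core: "tubey_core p q h R" and s: "s \<in> R" "(i, j) \<in> verts s"
    and t: "(i, j) \<in> verts (tri p q r c)" "1 \<le> r" "r \<le> 2 * int h" "1 \<le> c"
  shows "2 * i + j \<le> 2 * p + q + 2"
proof -
  \<comment> \<open>The shortest tube that reaches column \<open>c\<close>; the condition on the
    core concerns tubes of every length.\<close>
  define n where "n = nat c"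
  have "tri p q r c \<in> tube p q (real n / 2) h"
    unfolding tri_in_tube n_def using t by simp
  then have "point (i, j) \<in> area R \<inter> area (tube p q (real n / 2) h)"
    using s t(1) point_in_area by blast
  moreover have "real n / 2 \<in> half_nats" by (auto simp: half_nats_def)
  ultimately obtain e where e: "e \<in> western_boundary p q (real n / 2) h" "point (i, j) \<in> face e"
    using core unfolding tubey_core_def by blast
  define H where "H = {x :: real \<times> real. (1, 0) \<bullet> x \<le> of_int (2 * p + q + 2) / 2}"
  have H: "point (k, l) \<in> H \<longleftrightarrow> 2 * k + l \<le> 2 * p + q + 2" for k l
    unfolding H_def point_def by (simp add: inner_Pair) linarith
  have "point v \<in> H" if "v \<in> e" for v
  proof -
    obtain k l where v: "v = (k, l)" by (cases v)
    have "point (k, l) \<in> rectangle p q (real n / 2) h" "point (k - 1, l) \<notin> rectangle p q (real n / 2) h"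
      using e(1) that v by (auto simp: western_boundary_def)
    then have "2 * k + l \<le> 2 * p + q + 2"
      unfolding point_in_rectangle_half_iff by auto
    then show ?thesis using H v by simp
  qed
  moreover have "convex H"
    unfolding H_def by (rule convex_halfspace_le)
  ultimately have "face e \<subseteq> H"
    using face_subset_convex by blast
  then have "point (i, j) \<in> H" using e(2) by blast
  then show ?thesis using H by simp
qed

lemma ex_right_vertex:
  obtains i j where "(i, j) \<in> verts (tri p q r c)" "2 * i + j = 2 * p + q + c + 2"
proof (cases "even (r + c)")
  case True
  then obtain k where k: "c + r = 2 * k" by (metis add.commute evenE)
  then have c: "c = 2 * k - r" by simp
  have "(p + k + 1, q - r) \<in> verts (tri p q r c)"
    unfolding verts_tri_iff c by auto
  then show thesis using c by (intro that) auto
next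
  case False
  then obtain k where k: "c + r = 2 * k + 1" by (metis add.commute oddE)
  then have c: "c = 2 * k + 1 - r" by simp
  have "(p + k + 1, q - r + 1) \<in> verts (tri p q r c)"
    unfolding verts_tri_iff c by auto
  then show thesis using c by (intro that) auto
qed

text \<open>The right vertex of the triangle, at relative doubled abscissa \<open>c + 2\<close>,
  lies east of the western boundary.\<close>

lemma tri_notin_core:
  assumes "tubey_core p q h R" "1 \<le> r" "r \<le> 2 * int h" "1 \<le> c"
  shows "tri p q r c \<notin> R"
proof
  assume t: "tri p q r c \<in> R"
  obtain i j where ij: "(i, j) \<in> verts (tri p q r c)" "2 * i + j = 2 * p + q + c + 2"
    by (rule ex_right_vertex)
  show False
    using tubey_core_common_vertex[OF assms(1) t ij(1) ij(1) assms(2-4)] ij(2) assms(4) by simp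
qed

lemma vertical_common_vertex:
  assumes "even (r + c)"
  obtains i j where "(i, j) \<in> verts (tri p q r c)" "(i, j) \<in> verts (tri p q (r + 1) c)"
    "2 * i + j = 2 * p + q + c + 2"
proof -
  obtain k where k: "c + r = 2 * k" using assms by (metis add.commute evenE)
  then have c: "c = 2 * k - r" by simp
  have "(p + k + 1, q - r) \<in> verts (tri p q r c)" "(p + k + 1, q - r) \<in> verts (tri p q (r + 1) c)"
    unfolding verts_tri_iff c by auto
  then show thesis using c by (intro that) auto
qed

text \<open>The two triangles of a vertical lozenge share their right vertex, which is too far east
  for a core triangle. A horizontal neighbour stays in its row, so it can leave the tube only from
  column 1 to column 0.\<close>

lemma core_tube_lozenge:
  assumes core: "tubey_core p q h R" and s: "tri p q r' c' \<in> R" and t: "1 \<le> r" "r \<le> 2 * int h" "1 \<le> c"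
    and adj: "adjacent r c r' c'"
  shows "c = 1 \<and> c' = 0 \<and> r' = r"
proof -
  have out: "\<not> (1 \<le> r' \<and> r' \<le> 2 * int h \<and> 1 \<le> c')"
    using tri_notin_core[OF core] s by blast
  have no_vertical: "\<not> (c' = c \<and> (even (r + c) \<and> r' = r + 1 \<or> odd (r + c) \<and> r' = r - 1))"
  proof
    assume v: "c' = c \<and> (even (r + c) \<and> r' = r + 1 \<or> odd (r + c) \<and> r' = r - 1)"
    then have "r = 2 * int h \<and> even (r + c) \<or> r = 1 \<and> odd (r + c)"
      using out t by auto
    then have "c \<noteq> 1" by auto
    have "\<exists>i j. (i, j) \<in> verts (tri p q r c) \<and> (i, j) \<in> verts (tri p q r' c') \<and> 2 * i + j = 2 * p + q + c + 2"
    proof (cases "even (r + c)")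
      case True
      then show ?thesis using v vertical_common_vertex[of r c p q] by metis
    next
      case False
      then have "even (r' + c)" "r = r' + 1" using v by auto
      then show ?thesis using v vertical_common_vertex[of r' c p q] by metis
    qed
    then obtain i j where ij: "(i, j) \<in> verts (tri p q r c)" "(i, j) \<in> verts (tri p q r' c')"
      "2 * i + j = 2 * p + q + c + 2" by blast
    show False
      using tubey_core_common_vertex[OF core s ij(2,1) t] ij(3) t(3) \<open>c \<noteq> 1\<close> by simp
  qed
  then have "r' = r \<and> (c' = c + 1 \<or> c' = c - 1)"
    using adj by (auto simp: adjacent_def)
  then show ?thesis using out t by auto
qed

section \<open>Weights along the eastern boundary\<close>

lemma eastern_boundary_half_iff:
  assumes "e \<in> edges t"
  shows "e \<in> eastern_boundary p q (real n / 2) h \<longleftrightarrow>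
    (\<forall>(i, j)\<in>e. 2 * p + q + 1 \<le> 2 * i + j \<and> (2 * i + j = 2 * p + q + int n + 1 \<or> 2 * i + j = 2 * p + q + int n + 2) \<and>
       q - 2 * int h \<le> j \<and> j \<le> q)"
proof -
  have "(point (i, j) \<in> rectangle p q (real n / 2) h \<and> point (i + 1, j) \<notin> rectangle p q (real n / 2) h) \<longleftrightarrow>
      2 * p + q + 1 \<le> 2 * i + j \<and> (2 * i + j = 2 * p + q + int n + 1 \<or> 2 * i + j = 2 * p + q + int n + 2) \<and>
       q - 2 * int h \<le> j \<and> j \<le> q" for i j
    unfolding point_in_rectangle_half_iff by auto
  then show ?thesis
    unfolding eastern_boundary_def using assms by auto
qed

text \<open>The ends of a horizontal edge differ by 2 in doubled abscissa, so an eastern edge is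
  slanted. It therefore contains the vertex opposite the horizontal side, at \<open>c + 1\<close>,
  which must be \<open>n + 1\<close> or \<open>n + 2\<close>.\<close>

lemma eastern_edge_tri:
  assumes e: "e \<in> edges (tri p q r c)" "e \<in> eastern_boundary p q (real n / 2) h"
  shows "1 \<le> r \<and> r \<le> 2 * int h \<and> (c = int n \<or> c = int n + 1)"
proof -
  obtain i j k l where ev: "e = {(i, j), (k, l)}" "(i, j) \<noteq> (k, l)"
    "(i, j) \<in> verts (tri p q r c)" "(k, l) \<in> verts (tri p q r c)"
    using e(1) by (auto simp: edges_def card_2_iff)
  have X: "2 * i + j = 2 * p + q + int n + 1 \<or> 2 * i + j = 2 * p + q + int n + 2"
    "2 * k + l = 2 * p + q + int n + 1 \<or> 2 * k + l = 2 * p + q + int n + 2"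
    and bounds: "q - 2 * int h \<le> j" "j \<le> q" "q - 2 * int h \<le> l" "l \<le> q"
    using e(2)[unfolded eastern_boundary_half_iff[OF e(1)], unfolded ev(1)] by auto
  have "j \<noteq> l"
  proof
    assume "j = l"
    then have "i \<noteq> k" using ev(2) by auto
    then show False using X \<open>j = l\<close> by presburger
  qed
  have rows: "j = q - r \<or> j = q - r + 1" "l = q - r \<or> l = q - r + 1"
    using ev(3,4) unfolding verts_tri_iff by blast+
  have "2 * i + j = 2 * p + q + c + 1 \<or> 2 * k + l = 2 * p + q + c + 1"
  proof -
    have "2 * i + j = 2 * p + q + c + 1" if "\<not> (even (r + c) \<longleftrightarrow> j = q - r)"
      using ev(3) unfolding verts_tri_iff if_not_P[OF that] by simp
    moreover have "2 * k + l = 2 * p + q + c + 1" if "\<not> (even (r + c) \<longleftrightarrow> l = q - r)"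
      using ev(4) unfolding verts_tri_iff if_not_P[OF that] by simp
    moreover have "\<not> (j = q - r \<and> l = q - r)" "j = q - r \<or> l = q - r"
      using rows \<open>j \<noteq> l\<close> by auto
    ultimately show ?thesis by argo
  qed
  then have "c = int n \<or> c = int n + 1"
    using X by (elim disjE) simp_all
  moreover have "1 \<le> r" "r \<le> 2 * int h"
    using rows bounds \<open>j \<noteq> l\<close> by auto
  ultimately show ?thesis by simp
qed

lemma not_vertical_lozenge:
  "\<not> vertical_lozenge {tri p q r c, tri p q r (c + 1)}"
proof
  assume "vertical_lozenge {tri p q r c, tri p q r (c + 1)}"
  then obtain s t i j where st: "s \<noteq> t" "{(i, j), (i + 1, j)} \<in> edges s \<inter> edges t"
    "{tri p q r c, tri p q r (c + 1)} = {s, t}"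
    by (auto simp: vertical_lozenge_def)
  then have "s = tri p q r c \<and> t = tri p q r (c + 1) \<or> s = tri p q r (c + 1) \<and> t = tri p q r c"
    by (metis doubleton_eq_iff)
  then have "(i, j) \<in> verts (tri p q r c)" "(i + 1, j) \<in> verts (tri p q r c)"
    "(i, j) \<in> verts (tri p q r (c + 1))" "(i + 1, j) \<in> verts (tri p q r (c + 1))"
    using st(2) by (auto simp: edges_def)
  then show False
    unfolding verts_tri_iff by (auto split: if_splits)
qed

lemma eastern_vertical_lozenge:
  fixes p q :: int
  assumes "even (r + int n)" "1 \<le> r" "r < 2 * int h"
  defines "L \<equiv> {tri p q r (int n), tri p q (r + 1) (int n)}"
  shows "vertical_lozenge L \<and> card ((\<Union>t\<in>L. edges t) \<inter> eastern_boundary p q (real n / 2) h) = 2"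
proof -
  obtain k where k: "int n + r = 2 * k" using assms(1) by (metis add.commute evenE)
  have d: "(int n + (r + 1)) div 2 = k" using k by presburger
  have t1: "tri p q r (int n) = Up (p + k) (q - r)"
    using assms(1) k by (simp add: tri_def)
  have t2: "tri p q (r + 1) (int n) = Down (p + k) (q - r - 1)"
    using assms(1) d by (simp add: tri_def)
  have n: "int n = 2 * k - r" using k by simp
  \<comment> \<open>Top, right, bottom and left corner of the lozenge, at relative doubled abscissae
    \<open>n + 1\<close>, \<open>n + 2\<close>, \<open>n + 1\<close> and \<open>n\<close>. Only the
    two edges at the right corner are eastern.\<close>
  define A where "A = (p + k, q - r + 1)"
  define B where "B = (p + k + 1, q - r)"
  define C where "C = (p + k + 1, q - r - 1)"
  define W where "W = (p + k, q - r)"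
  have e1: "edges (tri p q r (int n)) = {{W, B}, {B, A}, {W, A}}"
    unfolding t1 edges_Up A_def B_def W_def ..
  have e2: "edges (tri p q (r + 1) (int n)) = {{W, B}, {B, C}, {W, C}}"
    unfolding t2 edges_Down B_def C_def W_def by simp
  have iff: "e \<in> eastern_boundary p q (real n / 2) h \<longleftrightarrow> (\<forall>(i, j)\<in>e. 2 * p + q + 1 \<le> 2 * i + j \<and>
      (2 * i + j = 2 * p + q + int n + 1 \<or> 2 * i + j = 2 * p + q + int n + 2) \<and> q - 2 * int h \<le> j \<and> j \<le> q)"
    if "e \<in> edges (tri p q r (int n)) \<or> e \<in> edges (tri p q (r + 1) (int n))" for e
    using that eastern_boundary_half_iff[of e _ p q n h] by blast
  note iff' = iff[unfolded e1 e2]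
  have wb: "{W, B} \<notin> eastern_boundary p q (real n / 2) h"
    by (subst iff') (simp_all add: W_def n)
  have wa: "{W, A} \<notin> eastern_boundary p q (real n / 2) h"
    by (subst iff') (simp_all add: W_def n)
  have wc: "{W, C} \<notin> eastern_boundary p q (real n / 2) h"
    by (subst iff') (simp_all add: W_def n)
  have ba: "{B, A} \<in> eastern_boundary p q (real n / 2) h"
    using assms(2,3) n by (subst iff') (simp_all add: A_def B_def)
  have bc: "{B, C} \<in> eastern_boundary p q (real n / 2) h"
    using assms(2,3) n by (subst iff') (simp_all add: C_def B_def)
  have "(\<Union>t\<in>L. edges t) \<inter> eastern_boundary p q (real n / 2) h = {{B, A}, {B, C}}"
    unfolding L_def using wa wb wc ba bc by (simp add: e1 e2) blast
  moreover have "{B, A} \<noteq> {B, C}"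
    by (auto simp: A_def B_def C_def doubleton_eq_iff)
  ultimately have "card ((\<Union>t\<in>L. edges t) \<inter> eastern_boundary p q (real n / 2) h) = 2"
    by simp
  moreover have "vertical_lozenge L"
    unfolding vertical_lozenge_def
  proof (intro exI conjI)
    show "tri p q r (int n) \<noteq> tri p q (r + 1) (int n)" by (simp add: tri_inject)
    show "{(p + k, q - r), (p + k + 1, q - r)} \<in> edges (tri p q r (int n)) \<inter> edges (tri p q (r + 1) (int n))"
      unfolding e1 e2 by (simp add: W_def B_def)
    show "L = {tri p q r (int n), tri p q (r + 1) (int n)}" by (simp add: L_def)
  qed
  ultimately show ?thesis by simp
qed

lemma overline_weight_eastern:
  assumes "even (r + int n)" "1 \<le> r" "r < 2 * int h"
  shows "overline_weight p q h w (real n / 2) {tri p q r (int n), tri p q (r + 1) (int n)} = 1 / 2"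
  using eastern_vertical_lozenge[OF assms, of p q] by (simp add: overline_weight_def)

lemma overline_weight_horizontal:
  "overline_weight p q h w a {tri p q r c, tri p q r (c + 1)} = w {tri p q r c, tri p q r (c + 1)}"
  using not_vertical_lozenge by (simp add: overline_weight_def)

lemma overline_weight_off_boundary:
  assumes "\<And>r c. tri p q r c \<in> L \<Longrightarrow> \<not> (1 \<le> r \<and> r \<le> 2 * int h \<and> (c = int n \<or> c = int n + 1))"
  shows "overline_weight p q h w (real n / 2) L = w L"
proof -
  have "(\<Union>t\<in>L. edges t) \<inter> eastern_boundary p q (real n / 2) h = {}"
  proof (rule equals0I)
    fix e assume "e \<in> (\<Union>t\<in>L. edges t) \<inter> eastern_boundary p q (real n / 2) h"
    then obtain t where t: "t \<in> L" "e \<in> edges t" "e \<in> eastern_boundary p q (real n / 2) h" by blast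
    obtain r c where "t = tri p q r c" by (rule tri_cases)
    then show False using t eastern_edge_tri[of e p q r c n h] assms[of r c] by blast
  qed
  then show ?thesis by (simp add: overline_weight_def)
qed

section \<open>Passing from column to column\<close>

text \<open>The possible lower rows of vertical lozenges in column \<open>c\<close>; the triangle
  above, in row \<open>x - 1\<close>, must point upwards.\<close>

definition lower_rows :: "nat \<Rightarrow> int \<Rightarrow> int set" where
  "lower_rows h c = {x. 2 \<le> x \<and> x \<le> 2 * int h \<and> odd (x + c)}"

definition pairs :: "int set \<Rightarrow> int set" where
  "pairs V = V \<union> (\<lambda>x. x - 1) ` V"

text \<open>
  \<open>S\<close> is the set of rows in which a lozenge reaches into column \<open>c\<close> from the west; it is
  complemented in the rows of the parity that may move in this column.
\<close>

definition particles :: "nat \<Rightarrow> int \<Rightarrow> int set \<Rightarrow> int set" where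
  "particles h c S = {x. 1 \<le> x \<and> x \<le> 2 * int h \<and> (x \<in> S \<longleftrightarrow> even (x + c))}"

lemma mem_pairs: "y \<in> pairs V \<longleftrightarrow> y \<in> V \<or> y + 1 \<in> V"
  by (auto simp: pairs_def intro: image_eqI[of _ _ "y + 1"])

lemma mem_move: "y \<in> move V P \<longleftrightarrow> y \<in> P \<and> y \<notin> V \<or> y + 1 \<in> V"
  by (auto simp: move_def intro: image_eqI[of _ _ "y + 1"])

lemma finite_lower_rows: "finite (lower_rows h c)"
proof (rule finite_subset)
  show "lower_rows h c \<subseteq> {1..2 * int h}" by (auto simp: lower_rows_def)
qed simp

text \<open>Only row \<open>x\<close> of the pair is complemented: both rows being free of
  \<open>S\<close> means a particle in \<open>x\<close> and none in \<open>x - 1\<close>.\<close>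

lemma pairs_subset_iff:
  assumes "V \<subseteq> lower_rows h c"
  shows "pairs V \<subseteq> {1..2 * int h} - S \<longleftrightarrow> V \<subseteq> movable (particles h c S)"
proof -
  have "x \<in> movable (particles h c S) \<longleftrightarrow> x \<notin> S \<and> x - 1 \<notin> S" if "x \<in> V" for x
  proof -
    have "2 \<le> x" "x \<le> 2 * int h" "odd (x + c)" using assms that by (auto simp: lower_rows_def)
    moreover from this have "even (x - 1 + c)" by simp
    ultimately show ?thesis by (simp add: movable_def particles_def)
  qed
  moreover have "x \<in> {1..2 * int h}" "x - 1 \<in> {1..2 * int h}" if "x \<in> V" for x
    using assms that by (auto simp: lower_rows_def)
  ultimately show ?thesis
    unfolding pairs_def by blast
qed

text \<open>The rows that neither \<open>S\<close> nor a vertical lozenge covers are crossed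
  eastwards, and the next column complements the other parity. The two complementations cancel in
  every row that \<open>V\<close> leaves alone.\<close>

lemma move_particles:
  assumes "V \<subseteq> lower_rows h c"
  shows "move V (particles h c S) = particles h (c + 1) ({1..2 * int h} - S - pairs V)"
proof (rule Set.set_eqI)
  fix y
  have V: "2 \<le> x \<and> x \<le> 2 * int h \<and> odd (x + c)" if "x \<in> V" for x
    using assms that by (auto simp: lower_rows_def)
  consider "y + 1 \<in> V" | "y \<in> V" "y + 1 \<notin> V" | "y \<notin> V" "y + 1 \<notin> V" by blast
  then show "y \<in> move V (particles h c S) \<longleftrightarrow> y \<in> particles h (c + 1) ({1..2 * int h} - S - pairs V)"
  proof cases
    case 1
    then have "even (y + c)" "1 \<le> y" "y \<le> 2 * int h" using V[of "y + 1"] by auto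
    then show ?thesis using 1 by (simp add: mem_move mem_pairs particles_def)
  next
    case 2
    then have "odd (y + c)" using V[of y] by simp
    then show ?thesis using 2 by (simp add: mem_move mem_pairs particles_def)
  next
    case 3
    then show ?thesis by (auto simp: mem_move mem_pairs particles_def)
  qed
qed

text \<open>The end condition: nothing crosses east of the last column. Its number being odd fixes
  which parity is occupied.\<close>

lemma particles_eq_odd_rows_iff:
  assumes "odd c" "S \<subseteq> {1..2 * int h}"
  shows "particles h (c + 1) S = odd_rows h \<longleftrightarrow> S = {}"
proof
  assume eq: "particles h (c + 1) S = odd_rows h"
  have "y \<notin> S" if "1 \<le> y" "y \<le> 2 * int h" for y
  proof -
    have "y \<in> particles h (c + 1) S \<longleftrightarrow> y \<in> odd_rows h" using eq by simp
    then show ?thesis using that assms(1) by (auto simp: particles_def odd_rows_def)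
  qed
  then show "S = {}" using assms(2) by auto
next
  assume "S = {}"
  then show "particles h (c + 1) S = odd_rows h"
    using assms(1) by (auto simp: particles_def odd_rows_def)
qed

section \<open>Tilings of one column and of the columns from it eastwards\<close>

definition strip :: "int \<Rightarrow> int \<Rightarrow> nat \<Rightarrow> int \<Rightarrow> int \<Rightarrow> int set \<Rightarrow> triangle set" where
  "strip p q h n c S =
     {tri p q r d |r d. 1 \<le> r \<and> r \<le> 2 * int h \<and> c \<le> d \<and> d \<le> n \<and> (d = c \<longrightarrow> r \<notin> S)}"

lemma tri_in_strip:
  "tri p q r d \<in> strip p q h n c S \<longleftrightarrow>
     1 \<le> r \<and> r \<le> 2 * int h \<and> c \<le> d \<and> d \<le> n \<and> (d = c \<longrightarrow> r \<notin> S)"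
  by (auto simp: strip_def tri_inject)

lemma finite_strip: "finite (strip p q h n c S)"
proof (rule finite_subset)
  show "strip p q h n c S \<subseteq> (\<lambda>(r, d). tri p q r d) ` ({1..2 * int h} \<times> {c..n})"
    by (auto simp: strip_def)
qed simp

lemma triangle_set_eqI:
  assumes "\<And>r c. tri p q r c \<in> X \<longleftrightarrow> tri p q r c \<in> Y"
  shows "X = Y"
proof (rule Set.set_eqI)
  fix t
  obtain r c where "t = tri p q r c" by (rule tri_cases)
  then show "t \<in> X \<longleftrightarrow> t \<in> Y" using assms by simp
qed

lemma strip_last:
  "strip p q h n n S = (\<lambda>r. tri p q r n) ` ({1..2 * int h} - S)"
  by (rule triangle_set_eqI[of p q]) (auto simp: tri_in_strip image_iff tri_inject)

text \<open>Only vertical lozenges fit into one column, and a triangle has a single vertical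
  neighbour, so they are pairwise disjoint and \<open>M_rigid\<close> applies.\<close>

lemma M_column:
  assumes Q: "Q \<subseteq> {1..2 * int h}"
    and u: "\<And>x. x \<in> lower_rows h c \<Longrightarrow> u {tri p q (x - 1) c, tri p q x c} = s"
  shows "M u ((\<lambda>r. tri p q r c) ` Q) =
    (\<Sum>V\<in>Pow (lower_rows h c). s ^ card V * of_bool (pairs V = Q))"
proof -
  define \<gamma> where "\<gamma> x = {tri p q (x - 1) c, tri p q x c}" for x
  have \<gamma>: "\<Union>(\<gamma> ` V) = (\<lambda>r. tri p q r c) ` pairs V" for V
    by (auto simp: \<gamma>_def pairs_def)
  have inj: "inj (\<lambda>r. tri p q r c)"
    by (auto simp: inj_def tri_inject)
  have "M u ((\<lambda>r. tri p q r c) ` Q) =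
      (\<Sum>V\<in>Pow (lower_rows h c). (\<Prod>x\<in>V. u (\<gamma> x)) * of_bool (\<Union>(\<gamma> ` V) = (\<lambda>r. tri p q r c) ` Q))"
  proof (rule M_rigid)
    show "finite ((\<lambda>r. tri p q r c) ` Q)" using Q finite_subset by blast
    show "finite (lower_rows h c)" by (rule finite_lower_rows)
    show "inj_on \<gamma> (lower_rows h c)"
      by (auto simp: inj_on_def \<gamma>_def doubleton_eq_iff tri_inject)
    show "x = y" if "x \<in> lower_rows h c" "y \<in> lower_rows h c" "\<gamma> x \<inter> \<gamma> y \<noteq> {}" for x y
    proof -
      have "x = y \<or> x = y - 1 \<or> x - 1 = y" using that(3) by (auto simp: \<gamma>_def tri_inject)
      then show ?thesis using that(1,2) by (auto simp: lower_rows_def)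
    qed
    show "lozenge L \<longleftrightarrow> (\<exists>x\<in>lower_rows h c. L = \<gamma> x)" if L: "L \<subseteq> (\<lambda>r. tri p q r c) ` Q" for L
    proof
      assume "lozenge L"
      then show "\<exists>x\<in>lower_rows h c. L = \<gamma> x"
      proof (cases rule: lozenge_cases[of L p q])
        case (horizontal r d)
        then have "d = c" "d + 1 = c" using L by (auto simp: tri_inject)
        then show ?thesis by simp
      next
        case (vertical r d)
        then have "d = c" "r \<in> Q" "r + 1 \<in> Q" using L by (auto simp: tri_inject)
        then have "r + 1 \<in> lower_rows h c" "L = \<gamma> (r + 1)"
          using vertical Q by (auto simp: lower_rows_def \<gamma>_def)
        then show ?thesis by blast
      qed
    next
      assume "\<exists>x\<in>lower_rows h c. L = \<gamma> x"
      then obtain x where "odd (x + c)" "L = {tri p q (x - 1) c, tri p q x c}"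
        by (auto simp: lower_rows_def \<gamma>_def)
      then show "lozenge L" by (simp add: lozenge_tri_iff adjacent_def)
    qed
  qed
  also have "\<dots> = (\<Sum>V\<in>Pow (lower_rows h c). s ^ card V * of_bool (pairs V = Q))"
  proof (rule sum.cong[OF refl])
    fix V assume "V \<in> Pow (lower_rows h c)"
    then have "(\<Prod>x\<in>V. u (\<gamma> x)) = (\<Prod>x\<in>V. s)"
      using u by (intro prod.cong) (auto simp: \<gamma>_def)
    then show "(\<Prod>x\<in>V. u (\<gamma> x)) * of_bool (\<Union>(\<gamma> ` V) = (\<lambda>r. tri p q r c) ` Q) =
        s ^ card V * of_bool (pairs V = Q)"
      unfolding \<gamma> inj_image_eq_iff[OF inj] by simp
  qed
  finally show ?thesis .
qed

text \<open>The vertical lozenges must cover exactly the rows outside \<open>S\<close>. In terms of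
  particles they lead to \<open>odd_rows h\<close>, and the sum is the one in
  \<open>minor_path_count_init\<close>.\<close>

lemma M_strip_last:
  assumes s: "s = 1 \<or> s = 1 / 2" and n: "odd n" and S: "S \<subseteq> {1..2 * int h}"
    and u: "\<And>x. x \<in> lower_rows h n \<Longrightarrow> u {tri p q (x - 1) n, tri p q x n} = s"
  shows "M u (strip p q h n n S) = minor h (path_count s) (particles h n S)"
proof -
  let ?A = "lower_rows h n" and ?P = "particles h n S" and ?Q = "{1..2 * int h} - S"
  have A: "?A = {x. 2 \<le> x \<and> x \<le> 2 * int h \<and> even x}"
    using n by (auto simp: lower_rows_def)
  have P: "?P \<subseteq> {1..2 * int h}" by (auto simp: particles_def)
  have eq: "s ^ card V * of_bool (pairs V = ?Q) =
      (if V \<in> Pow (?A \<inter> movable ?P) then s ^ card V * of_bool (move V ?P = odd_rows h) else 0)"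
    if V: "V \<in> Pow ?A" for V
  proof (cases "pairs V \<subseteq> ?Q")
    case True
    then have "V \<in> Pow (?A \<inter> movable ?P)" using pairs_subset_iff V by blast
    moreover have "move V ?P = odd_rows h \<longleftrightarrow> ?Q - pairs V = {}"
      using V move_particles[of V h n S] particles_eq_odd_rows_iff[OF n, of "?Q - pairs V" h] by auto
    ultimately show ?thesis using True by auto
  next
    case False
    then have "V \<notin> Pow (?A \<inter> movable ?P)" using pairs_subset_iff V by blast
    moreover have "pairs V \<noteq> ?Q" using False by blast
    ultimately show ?thesis by (simp only: if_False of_bool_eq mult_zero_right)
  qed
  have "M u (strip p q h n n S) = (\<Sum>V\<in>Pow ?A. s ^ card V * of_bool (pairs V = ?Q))"
    unfolding strip_last by (rule M_column) (use u in auto)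
  also have "\<dots> = (\<Sum>V\<in>Pow ?A. if V \<in> Pow (?A \<inter> movable ?P)
      then s ^ card V * of_bool (move V ?P = odd_rows h) else 0)"
    using eq by (rule sum.cong[OF refl])
  also have "\<dots> = (\<Sum>V\<in>Pow (?A \<inter> movable ?P). s ^ card V * of_bool (move V ?P = odd_rows h))"
    using finite_lower_rows[of h n] by (subst sum.inter_restrict[symmetric]) (auto intro!: sum.cong)
  also have "\<dots> = minor h (path_count s) ?P"
    unfolding minor_path_count_init[OF s P] A ..
  finally show ?thesis .
qed

text \<open>Cutting between columns \<open>c\<close> and \<open>c + 1\<close> gives a sum over the
  crossing rows \<open>S'\<close> and the vertical lozenges \<open>V\<close>. It collapses to the
  expansion of a minor after row operations.\<close>

lemma M_strip_step:
  assumes c: "c < n" and S: "S \<subseteq> {1..2 * int h}"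
    and uv: "\<And>x. x \<in> lower_rows h c \<Longrightarrow> u {tri p q (x - 1) c, tri p q x c} = 1"
    and uh: "\<And>r. 1 \<le> r \<Longrightarrow> r \<le> 2 * int h \<Longrightarrow> u {tri p q r c, tri p q r (c + 1)} = 1"
    and IH: "\<And>S. S \<subseteq> {1..2 * int h} \<Longrightarrow> M u (strip p q h n (c + 1) S) = minor h f (particles h (c + 1) S)"
  shows "M u (strip p q h n c S) = minor h (step 1 (lower_rows h c) f) (particles h c S)"
proof -
  let ?A = "lower_rows h c" and ?P = "particles h c S" and ?I = "{1..2 * int h} - S"
  let ?\<alpha> = "\<lambda>r. tri p q r c" and ?\<beta> = "\<lambda>r. tri p q r (c + 1)"
  have inj: "inj ?\<alpha>" "inj ?\<beta>" by (auto simp: inj_def tri_inject)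
  have Un: "strip p q h n c S = ?\<alpha> ` ?I \<union> strip p q h n (c + 1) {}"
    using c by (intro triangle_set_eqI[of p q]) (auto simp: tri_in_strip image_iff tri_inject)
  have "M u (?\<alpha> ` ?I \<union> strip p q h n (c + 1) {}) =
      (\<Sum>S'\<in>Pow ?I. (\<Prod>r\<in>S'. u {?\<alpha> r, ?\<beta> r}) *
        (M u (?\<alpha> ` ?I - ?\<alpha> ` S') * M u (strip p q h n (c + 1) {} - ?\<beta> ` S')))"
  proof (rule M_split)
    show "?\<alpha> ` ?I \<inter> strip p q h n (c + 1) {} = {}"
      by (auto simp: tri_in_strip)
    show "?\<beta> ` ?I \<subseteq> strip p q h n (c + 1) {}"
      using c by (auto simp: tri_in_strip)
    show "lozenge {?\<alpha> r, ?\<beta> r}" if "r \<in> ?I" for r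
      by (simp add: lozenge_tri_iff adjacent_def)
    show "\<exists>r\<in>?I. L = {?\<alpha> r, ?\<beta> r}"
      if L: "lozenge L" "L \<subseteq> ?\<alpha> ` ?I \<union> strip p q h n (c + 1) {}" "\<not> L \<subseteq> ?\<alpha> ` ?I"
        "\<not> L \<subseteq> strip p q h n (c + 1) {}" for L
    proof -
      have in1: "tri p q r d \<in> ?\<alpha> ` ?I \<longleftrightarrow> d = c \<and> r \<in> ?I" for r d
        by (auto simp: tri_inject)
      from L(1) show ?thesis
      proof (cases rule: lozenge_cases[of L p q])
        case (horizontal r d)
        have "d = c \<and> r \<in> ?I"
          using L(2-4) unfolding horizontal insert_subset Un_iff in1 tri_in_strip by auto
        then show ?thesis using horizontal by blast
      next
        case (vertical r d)
        then show ?thesis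
          using L(2-4) unfolding vertical insert_subset Un_iff in1 tri_in_strip by auto
      qed
    qed
  qed (use inj in \<open>auto simp: finite_strip intro: inj_on_subset\<close>)
  also have "\<dots> = (\<Sum>S'\<in>Pow ?I. \<Sum>V\<in>Pow ?A. of_bool (pairs V = ?I - S') * minor h f (particles h (c + 1) S'))"
  proof (rule sum.cong[OF refl])
    fix S' assume S': "S' \<in> Pow ?I"
    have "(\<Prod>r\<in>S'. u {?\<alpha> r, ?\<beta> r}) = 1"
      using S' uh by (intro prod.neutral) auto
    moreover have "M u (?\<alpha> ` ?I - ?\<alpha> ` S') = (\<Sum>V\<in>Pow ?A. 1 ^ card V * of_bool (pairs V = ?I - S'))"
      unfolding image_set_diff[OF inj(1), symmetric] by (rule M_column) (use uv in auto)
    moreover have "strip p q h n (c + 1) {} - ?\<beta> ` S' = strip p q h n (c + 1) S'"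
      by (rule triangle_set_eqI[of p q]) (auto simp: tri_in_strip image_iff tri_inject)
    moreover have "M u (strip p q h n (c + 1) S') = minor h f (particles h (c + 1) S')"
      using S' by (intro IH) auto
    ultimately show "(\<Prod>r\<in>S'. u {?\<alpha> r, ?\<beta> r}) *
        (M u (?\<alpha> ` ?I - ?\<alpha> ` S') * M u (strip p q h n (c + 1) {} - ?\<beta> ` S')) =
        (\<Sum>V\<in>Pow ?A. of_bool (pairs V = ?I - S') * minor h f (particles h (c + 1) S'))"
      by (simp add: sum_distrib_right)
  qed
  \<comment> \<open>For fixed \<open>V\<close> at most one \<open>S'\<close> contributes: the rows
    that \<open>S\<close> and \<open>pairs V\<close> leave over.\<close>
  also have "\<dots> = (\<Sum>V\<in>Pow ?A. \<Sum>S'\<in>Pow ?I. of_bool (pairs V = ?I - S') * minor h f (particles h (c + 1) S'))"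
    by (rule sum.swap)
  also have "\<dots> = (\<Sum>V\<in>Pow ?A. if V \<in> Pow (?A \<inter> movable ?P) then minor h f (move V ?P) else 0)"
  proof (rule sum.cong[OF refl])
    fix V assume V: "V \<in> Pow ?A"
    show "(\<Sum>S'\<in>Pow ?I. of_bool (pairs V = ?I - S') * minor h f (particles h (c + 1) S')) =
        (if V \<in> Pow (?A \<inter> movable ?P) then minor h f (move V ?P) else 0)"
    proof (cases "pairs V \<subseteq> ?I")
      case True
      have "pairs V = ?I - S' \<longleftrightarrow> S' = ?I - pairs V" if "S' \<in> Pow ?I" for S'
        using that True by blast
      then have "(\<Sum>S'\<in>Pow ?I. of_bool (pairs V = ?I - S') * minor h f (particles h (c + 1) S')) =
          (\<Sum>S'\<in>Pow ?I. if S' = ?I - pairs V then minor h f (particles h (c + 1) S') else 0)"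
        by (intro sum.cong) auto
      also have "\<dots> = minor h f (particles h (c + 1) (?I - pairs V))"
        by (subst sum.delta) auto
      also have "\<dots> = minor h f (move V ?P)"
        using V by (subst move_particles) auto
      finally show ?thesis
        using True pairs_subset_iff[of V h c S] V by auto
    next
      case False
      then have "(\<Sum>S'\<in>Pow ?I. of_bool (pairs V = ?I - S') * minor h f (particles h (c + 1) S')) = 0"
        by (intro sum.neutral) auto
      then show ?thesis
        using False pairs_subset_iff[of V h c S] V by auto
    qed
  qed
  also have "\<dots> = (\<Sum>V\<in>Pow (?A \<inter> movable ?P). 1 ^ card V * minor h f (move V ?P))"
    using finite_lower_rows[of h c] by (subst sum.inter_restrict[symmetric]) (auto intro!: sum.cong)
  also have "\<dots> = minor h (step 1 ?A f) ?P"
  proof (rule minor_step[symmetric])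
    show "finite ?A" by (rule finite_lower_rows)
    have "?P \<subseteq> {1..2 * int h}" by (auto simp: particles_def)
    then show "finite ?P" using finite_subset by blast
    show "x - 1 \<notin> ?A" if "x \<in> ?A" for x using that by (auto simp: lower_rows_def)
  qed
  finally show ?thesis unfolding Un .
qed

section \<open>The core\<close>

text \<open>The induction runs westwards from the last column, two columns at a time: the parity of
  the column is then kept and \<open>path_count_step\<close> raises \<open>y\<close> by 1.\<close>

lemma M_strip:
  assumes s: "s = 1 \<or> s = 1 / 2" and n: "odd n"
    and last: "\<And>x. x \<in> lower_rows h n \<Longrightarrow> u {tri p q (x - 1) n, tri p q x n} = s"
    and vertical: "\<And>c x. 1 \<le> c \<Longrightarrow> c < n \<Longrightarrow> x \<in> lower_rows h c \<Longrightarrow> u {tri p q (x - 1) c, tri p q x c} = 1"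
    and horizontal: "\<And>c r. 1 \<le> c \<Longrightarrow> c < n \<Longrightarrow> 1 \<le> r \<Longrightarrow> r \<le> 2 * int h \<Longrightarrow>
      u {tri p q r c, tri p q r (c + 1)} = 1"
  shows "1 \<le> n - 2 * int m \<Longrightarrow> S \<subseteq> {1..2 * int h} \<Longrightarrow>
    M u (strip p q h n (n - 2 * int m) S) = minor h (path_count (s + real m)) (particles h (n - 2 * int m) S)"
proof (induction m arbitrary: S)
  case 0
  then show ?case using M_strip_last[OF s n, of S h u p q] last by simp
next
  case (Suc m)
  define c where "c = n - 2 * int m - 2"
  define f where "f = path_count (s + real m)"
  have c1: "1 \<le> c" "c < n" "c + 1 < n" "odd c" using Suc.prems(1) n by (auto simp: c_def)
  have base: "M u (strip p q h n (c + 1 + 1) S) = minor h f (particles h (c + 1 + 1) S)" if "S \<subseteq> {1..2 * int h}" for S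
    using Suc.IH[OF _ that] Suc.prems(1) by (simp add: c_def f_def)
  have base': "M u (strip p q h n (c + 1) S) = minor h (step 1 (lower_rows h (c + 1)) f) (particles h (c + 1) S)"
    if "S \<subseteq> {1..2 * int h}" for S
    by (rule M_strip_step[OF c1(3) that vertical horizontal base]) (use c1 in simp_all)
  have "M u (strip p q h n c S) =
      minor h (step 1 (lower_rows h c) (step 1 (lower_rows h (c + 1)) f)) (particles h c S)"
    by (rule M_strip_step[OF c1(2) Suc.prems(2) vertical horizontal base']) (use c1 in simp_all)
  also have "lower_rows h c = {x. 2 \<le> x \<and> x \<le> 2 * int h \<and> even x}"
    using c1 by (auto simp: lower_rows_def)
  also have "lower_rows h (c + 1) = {x. 2 \<le> x \<and> x \<le> 2 * int h \<and> odd x}"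
    using c1 by (auto simp: lower_rows_def)
  also have "minor h (step 1 {x. 2 \<le> x \<and> x \<le> 2 * int h \<and> even x}
      (step 1 {x. 2 \<le> x \<and> x \<le> 2 * int h \<and> odd x} f)) (particles h c S) =
      minor h (path_count (s + real m + 1)) (particles h c S)"
  proof (rule minor_cong)
    have "particles h c S \<subseteq> {1..2 * int h}" by (auto simp: particles_def)
    then show "finite (particles h c S)" using finite_subset by blast
  qed (auto simp: f_def particles_def intro: path_count_step)
  finally show ?case by (simp add: c_def algebra_simps)
qed

lemma strip_Int_core:
  assumes "tubey_core p q h R"
  shows "R \<inter> strip p q h n 1 {} = {}"
  using tri_notin_core[OF assms] by (auto simp: strip_def)

lemma M_tubey_region:
  fixes R :: "triangle set"
  assumes core: "tubey_core p q h R" and s: "s = 1 \<or> s = 1 / 2" and n: "n = 2 * int m + 1"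
    and last: "\<And>x. x \<in> lower_rows h n \<Longrightarrow> u {tri p q (x - 1) n, tri p q x n} = s"
    and vertical: "\<And>c x. 1 \<le> c \<Longrightarrow> c < n \<Longrightarrow> x \<in> lower_rows h c \<Longrightarrow> u {tri p q (x - 1) c, tri p q x c} = 1"
    and horizontal: "\<And>c r. 1 \<le> c \<Longrightarrow> c < n \<Longrightarrow> 1 \<le> r \<Longrightarrow> r \<le> 2 * int h \<Longrightarrow>
      u {tri p q r c, tri p q r (c + 1)} = 1"
  shows "M u (R \<union> strip p q h n 1 {}) =
    (\<Sum>S\<in>Pow {r\<in>{1..2 * int h}. tri p q r 0 \<in> R}.
       (\<Prod>r\<in>S. u {tri p q r 0, tri p q r 1}) * M u (R - (\<lambda>r. tri p q r 0) ` S) *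
       minor h (path_count (s + real m)) (particles h 1 S))"
proof -
  let ?I = "{r\<in>{1..2 * int h}. tri p q r 0 \<in> R}"
  let ?\<alpha> = "\<lambda>r. tri p q r 0" and ?\<beta> = "\<lambda>r. tri p q r 1" and ?Y = "strip p q h n 1 {}"
  have "bounded (area R)" using core by (simp add: tubey_core_def region_def)
  then have finR: "finite R" by (rule finite_if_bounded_area)
  have "M u (R \<union> ?Y) = (\<Sum>S\<in>Pow ?I. (\<Prod>r\<in>S. u {?\<alpha> r, ?\<beta> r}) *
      (M u (R - ?\<alpha> ` S) * M u (?Y - ?\<beta> ` S)))"
  proof (rule M_split)
    show "R \<inter> ?Y = {}" by (rule strip_Int_core[OF core])
    show "inj_on ?\<alpha> ?I" "inj_on ?\<beta> ?I" by (auto simp: inj_on_def tri_inject)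
    show "?\<alpha> ` ?I \<subseteq> R" by auto
    show "?\<beta> ` ?I \<subseteq> ?Y" using n by (auto simp: tri_in_strip)
    show "lozenge {?\<alpha> r, ?\<beta> r}" for r by (simp add: lozenge_tri_iff adjacent_def)
    show "\<exists>r\<in>?I. L = {?\<alpha> r, ?\<beta> r}" if L: "lozenge L" "L \<subseteq> R \<union> ?Y" "\<not> L \<subseteq> R" "\<not> L \<subseteq> ?Y" for L
    proof -
      obtain t1 t2 where t: "L = {t1, t2}" using L(1) by (auto simp: lozenge_def)
      then obtain s' t' where st: "L = {s', t'}" "s' \<in> R" "t' \<in> ?Y"
        using L(2-4) by auto
      obtain r' c' where s': "s' = tri p q r' c'" by (rule tri_cases)
      obtain r c where t': "t' = tri p q r c" by (rule tri_cases)
      have t_range: "1 \<le> r" "r \<le> 2 * int h" "1 \<le> c"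
        using st(3) unfolding t' tri_in_strip by auto
      have "adjacent r c r' c'"
        using L(1) lozenge_tri_iff[of p q r c r' c'] unfolding st(1) s' t' by (simp add: insert_commute)
      then have "c = 1 \<and> c' = 0 \<and> r' = r"
        using core_tube_lozenge[OF core] st(2) t_range unfolding s' by blast
      then show ?thesis
        using st t_range unfolding s' t' by (intro bexI[of _ r]) auto
    qed
    show "finite ?I" by (rule finite_subset[of _ "{1..2 * int h}"]) auto
  qed (use finR finite_strip in auto)
  also have "\<dots> = (\<Sum>S\<in>Pow ?I. (\<Prod>r\<in>S. u {?\<alpha> r, ?\<beta> r}) * M u (R - ?\<alpha> ` S) *
      minor h (path_count (s + real m)) (particles h 1 S))"
  proof (rule sum.cong[OF refl])
    fix S assume "S \<in> Pow ?I"
    then have S: "S \<subseteq> {1..2 * int h}" by blast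
    have "?Y - ?\<beta> ` S = strip p q h n 1 S"
      by (rule triangle_set_eqI[of p q]) (auto simp: tri_in_strip image_iff tri_inject)
    \<comment> \<open>After \<open>m\<close> double columns the induction has reached column
      1.\<close>
    moreover have "M u (strip p q h n 1 S) = minor h (path_count (s + real m)) (particles h 1 S)"
      using M_strip[OF s _ last vertical horizontal _ S, of m] n by simp
    ultimately show "(\<Prod>r\<in>S. u {?\<alpha> r, ?\<beta> r}) * (M u (R - ?\<alpha> ` S) * M u (?Y - ?\<beta> ` S)) =
        (\<Prod>r\<in>S. u {?\<alpha> r, ?\<beta> r}) * M u (R - ?\<alpha> ` S) * minor h (path_count (s + real m)) (particles h 1 S)"
      by simp
  qed
  finally show ?thesis .
qed

theorem mainTheorem7:
  fixes p q :: int and h :: nat and R :: "triangle set" and w :: "triangle set \<Rightarrow> real"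
  assumes "h > 0"
    and "tubey_core p q h R"
    and "\<And>a L. a \<in> half_nats \<Longrightarrow> lozenge L \<Longrightarrow> L \<subseteq> tube p q a h \<Longrightarrow> w L = 1"
    and "\<And>a. a \<in> half_nats \<Longrightarrow> tileable (tubey_region p q h R a)"
  shows "\<exists>g g' :: real poly.
           (\<forall>a::nat. M w (tubey_region p q h R (real a + 1 / 2)) = poly g (real a)) \<and>
           (\<forall>a::nat. M (overline_weight p q h w (real a + 1 / 2))
                         (tubey_region p q h R (real a + 1 / 2)) = poly g' (real a)) \<and>
           (\<forall>x::real. poly g' x = poly g (x - 1 / 2))"
proof -
  note core = assms(2)
  define I where "I = {r\<in>{1..2 * int h}. tri p q r 0 \<in> R}"
  define \<kappa> where "\<kappa> S = (\<Prod>r\<in>S. w {tri p q r 0, tri p q r 1}) * M w (R - (\<lambda>r. tri p q r 0) ` S)" for S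
  define G where "G y = (\<Sum>S\<in>Pow I. \<kappa> S * minor h (path_count y) (particles h 1 S))" for y
  have "I \<subseteq> {1..2 * int h}" by (auto simp: I_def)
  then have "finite I" using finite_subset by blast
  then have "real_polynomial_function G"
    unfolding G_def by (intro real_polynomial_function_sum real_polynomial_function.intros(2,4)
        minor_path_count_polynomial) simp
  then obtain g where g: "\<And>y. G y = poly g y"
    using real_polynomial_function_poly by blast
  \<comment> \<open>A tube of length m + 1/2 has 2 m + 1 columns, an odd number as the end condition
    requires.\<close>
  have half: "real m + 1 / 2 = real (2 * m + 1) / 2" for m by simp
  have region: "tubey_region p q h R (real m + 1 / 2) = R \<union> strip p q h (2 * int m + 1) 1 {}" for m
  proof -
    have "int (2 * m + 1) = 2 * int m + 1" by simp
    then show ?thesis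
      unfolding tubey_region_def half tube_eq strip_def by (simp only: empty_iff not_False_eq_True simp_thms)
  qed
  have w1: "w {tri p q r c, tri p q r' c'} = 1"
    if "adjacent r c r' c'" "1 \<le> r" "r \<le> 2 * int h" "1 \<le> c" "1 \<le> r'" "r' \<le> 2 * int h" "1 \<le> c'" for r c r' c'
  proof -
    \<comment> \<open>The weights are known inside tubes of every length; this one contains both
      triangles.\<close>
    let ?n = "nat (max c c')"
    have sub: "{tri p q r c, tri p q r' c'} \<subseteq> tube p q (real ?n / 2) h"
      unfolding insert_subset tri_in_tube using that by auto
    have loz: "lozenge {tri p q r c, tri p q r' c'}"
      using that(1) lozenge_tri_iff by simp
    have "real ?n / 2 \<in> half_nats"
      unfolding half_nats_def by blast
    then show ?thesis by (rule assms(3)[OF _ loz sub])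
  qed
  have wv: "w {tri p q (x - 1) c, tri p q x c} = 1" if "1 \<le> c" "x \<in> lower_rows h c" for c x
    using that by (intro w1) (auto simp: lower_rows_def adjacent_def)
  have wh: "w {tri p q r c, tri p q r (c + 1)} = 1" if "1 \<le> c" "1 \<le> r" "r \<le> 2 * int h" for r c
    using that by (intro w1) (auto simp: adjacent_def)
  have eq1: "M w (tubey_region p q h R (real m + 1 / 2)) = G (1 + real m)" for m
    unfolding region G_def \<kappa>_def I_def
    by (rule M_tubey_region[OF core]) (use wv wh in auto)
  have eq2: "M (overline_weight p q h w (real m + 1 / 2)) (tubey_region p q h R (real m + 1 / 2)) = G (1 / 2 + real m)"
    for m
  proof -
    define n where "n = 2 * m + 1"
    define u where "u = overline_weight p q h w (real n / 2)"
    have u: "overline_weight p q h w (real m + 1 / 2) = u"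
      by (simp only: u_def n_def half)
    have n: "int n = 2 * int m + 1" by (simp add: n_def)
    have "M u (R \<union> strip p q h (int n) 1 {}) =
      (\<Sum>S\<in>Pow I. (\<Prod>r\<in>S. u {tri p q r 0, tri p q r 1}) * M u (R - (\<lambda>r. tri p q r 0) ` S) *
       minor h (path_count (1 / 2 + real m)) (particles h 1 S))"
      unfolding I_def
    proof (rule M_tubey_region[OF core _ n])
      show "u {tri p q (x - 1) (int n), tri p q x (int n)} = 1 / 2" if "x \<in> lower_rows h (int n)" for x
        using overline_weight_eastern[of "x - 1" n h p q w] that by (simp add: u_def lower_rows_def)
      show "u {tri p q (x - 1) c, tri p q x c} = 1" if "1 \<le> c" "c < int n" "x \<in> lower_rows h c" for c x
      proof -
        have "u {tri p q (x - 1) c, tri p q x c} = w {tri p q (x - 1) c, tri p q x c}"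
          unfolding u_def by (rule overline_weight_off_boundary) (use that in \<open>auto simp: tri_inject\<close>)
        then show ?thesis using wv that by simp
      qed
      show "u {tri p q r c, tri p q r (c + 1)} = 1" if "1 \<le> c" "1 \<le> r" "r \<le> 2 * int h" for c r
        using overline_weight_horizontal wh that by (simp add: u_def)
    qed simp
    also have "\<dots> = G (1 / 2 + real m)"
    proof -
      \<comment> \<open>For \<open>n = 1\<close> such a lozenge may have edges on the eastern
        boundary; it keeps its weight because it is not vertical.\<close>
      have "u {tri p q r 0, tri p q r 1} = w {tri p q r 0, tri p q r 1}" for r
        using overline_weight_horizontal[of p q h w _ r 0] by (simp add: u_def)
      \<comment> \<open>By \<open>eastern_edge_tri\<close> eastern edges belong to triangles in
        columns \<open>n\<close> and \<open>n + 1\<close> of the rows of the tube, and the core has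
        none there.\<close>
      moreover have "M u (R - X) = M w (R - X)" for X
      proof (rule M_cong)
        fix L assume "L \<subseteq> R - X"
        then show "u L = w L"
          unfolding u_def using tri_notin_core[OF core] n
          by (intro overline_weight_off_boundary) fastforce
      qed
      ultimately show ?thesis by (simp add: G_def \<kappa>_def)
    qed
    finally show ?thesis unfolding u region n .
  qed
  show ?thesis
  proof (intro exI conjI allI)
    \<comment> \<open>The same \<open>G\<close> is evaluated at 1 + a and at 1/2 + a; the two
      compositions translate its argument accordingly.\<close>
    show "M w (tubey_region p q h R (real a + 1 / 2)) = poly (pcompose g [:1, 1:]) (real a)" for a
      by (simp add: eq1 g poly_pcompose)
    show "M (overline_weight p q h w (real a + 1 / 2)) (tubey_region p q h R (real a + 1 / 2)) =
        poly (pcompose g [:1 / 2, 1:]) (real a)" for a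
      by (simp add: eq2 g poly_pcompose)
    show "poly (pcompose g [:1 / 2, 1:]) x = poly (pcompose g [:1, 1:]) (x - 1 / 2)" for x :: real
      by (simp add: poly_pcompose)
  qed
qed

end
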